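(* Let $a,b>0$ and let $\Omega_{a,b}=\{x+iy\in\mathbb{C}: x^2/a^2+y^2/b^2\le1\}$. Let $\mathcal{H}$ be a complex Hilbert space and $T:\mathcal{H}\to\mathcal{H}$ a bounded linear operator whose numerical range $W(T)$ is contained in (or equal to) $\Omega_{a,b}$. Then for every complex polynomial $p$, $$\|p(T)\|\le K(a,b)\sup_{z\in\Omega_{a,b}}|p(z)|,\qquad\text{where}\quad K(a,b):=1+\sqrt{1+\frac{2}{\pi}\arctan\Bigl(\frac12\Bigl|\frac ba-\frac ab\Bigr|\Bigr)}.$$
   Context: The numerical range of $T$ is $W(T)=\{\langle Tx,x\rangle:x\in\mathcal{H},\ \|x\|=1\}$, and $\|p(T)\|$ is the operator norm. *)

theory Defs
  imports "HOL-Analysis.Analysis" "HOL-Computational_Algebra.Polynomial"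
begin

text \<open>
  Complex inner product spaces are built on top of \<^class>\<open>real_inner\<close>: the underlying real inner
  product is the real part of the complex one. Positive definiteness of \<open>cinner\<close> and
  \<open>norm x = sqrt (Re (cinner x x))\<close> are then inherited from \<^class>\<open>real_inner\<close>. The complex inner
  product is linear in its first argument.
\<close>

class complex_inner = real_inner +
  fixes scaleC :: "complex \<Rightarrow> 'a \<Rightarrow> 'a"  (infixr "*\<^sub>C" 75)
    and cinner :: "'a \<Rightarrow> 'a \<Rightarrow> complex"
  assumes scaleC_add_right: "c *\<^sub>C (x + y) = c *\<^sub>C x + c *\<^sub>C y"
    and scaleC_add_left: "(c + d) *\<^sub>C x = c *\<^sub>C x + d *\<^sub>C x"
    and scaleC_scaleC: "c *\<^sub>C d *\<^sub>C x = (c * d) *\<^sub>C x"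
    and scaleC_of_real: "complex_of_real r *\<^sub>C x = r *\<^sub>R x"
    and cinner_commute: "cinner x y = cnj (cinner y x)"
    and cinner_add_left: "cinner (x + y) z = cinner x z + cinner y z"
    and cinner_scaleC_left: "cinner (c *\<^sub>C x) y = c * cinner x y"
    and inner_eq_Re_cinner: "inner x y = Re (cinner x y)"

class complex_hilbert_space = complex_inner + complete_space

instantiation complex :: complex_hilbert_space
begin

definition scaleC_complex :: "complex \<Rightarrow> complex \<Rightarrow> complex"
  where "scaleC_complex c x = c * x"

definition cinner_complex :: "complex \<Rightarrow> complex \<Rightarrow> complex"
  where "cinner_complex x y = x * cnj y"

instance
  by standard
    (simp_all add: scaleC_complex_def cinner_complex_def algebra_simps scaleR_conv_of_real
      inner_complex_def)

end

lemma cinner_self: "cinner x x = complex_of_real ((norm x)\<^sup>2)"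
  for x :: "'a::complex_inner"
proof -
  have "Im (cinner x x) = 0"
    using arg_cong[OF cinner_commute[of x x], of Im] by simp
  then show ?thesis
    by (simp add: complex_eq_iff power2_norm_eq_inner inner_eq_Re_cinner)
qed

definition bounded_clinear :: "('a::complex_inner \<Rightarrow> 'a) \<Rightarrow> bool"
  where "bounded_clinear T \<longleftrightarrow> bounded_linear T \<and> (\<forall>c x. T (c *\<^sub>C x) = c *\<^sub>C T x)"

definition numerical_range :: "('a::complex_inner \<Rightarrow> 'a) \<Rightarrow> complex set"
  where "numerical_range T = {cinner (T x) x | x. norm x = 1}"

definition op_poly :: "complex poly \<Rightarrow> ('a::complex_inner \<Rightarrow> 'a) \<Rightarrow> 'a \<Rightarrow> 'a"
  where "op_poly p T = (\<lambda>x. \<Sum>i\<le>degree p. coeff p i *\<^sub>C (T ^^ i) x)"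

definition ellipse_region :: "real \<Rightarrow> real \<Rightarrow> complex set"
  where "ellipse_region a b = {z. (Re z)\<^sup>2 / a\<^sup>2 + (Im z)\<^sup>2 / b\<^sup>2 \<le> 1}"

definition ellipse_const :: "real \<Rightarrow> real \<Rightarrow> real"
  where "ellipse_const a b = 1 + sqrt (1 + 2 / pi * arctan (1 / 2 * \<bar>b / a - a / b\<bar>))"

end

(*
  On the boundary of the ellipse, parametrized by the unit circle, the Faber polynomials take the
  values w^n + q^n w^(-n), where q = (a - b) / (a + b). Hence the Cauchy transform g of the
  conjugate of a polynomial f is again a polynomial, and its conjugate on the boundary is a Poisson
  integral of f at radius q. Subtracting (1 - q^2) / (1 + q^2) from the Poisson kernel leaves a
  kernel of L1-norm (4 / pi) arctan |q| = (2 / pi) arctan (|b/a - a/b| / 2), so that g is within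
  this distance alpha of a constant whenever |f| is bounded by 1.

  For an operator S with numerical range in the interior of the ellipse, positivity of the
  double layer kernel gives norm (f(S) + g(S)^* ) <= 2 (Crouzeix and Palencia). Let K be the best
  constant for S, and let f, x be nearly extremal. Then f(S) x is nearly orthogonal to x
  (Caldwell, Greenbaum and Li), so the constant may be removed from g, and evaluating f (g - c) f
  at S yields K^2 <= 2 K + alpha. The operator T is reached by letting S = r T with r -> 1.
*)

theory Submission
  imports Defs "HOL-Complex_Analysis.Complex_Analysis"
begin

section \<open>Complex inner product spaces and polynomials of operators\<close>

text \<open>Neither an extremal polynomial nor an extremal vector need exist, so each variational
  identity of the extremal case is proved only up to an error: a defect \<open>t^2\<close> in
  extremality is played off against perturbations of size \<open>t\<close>, which leaves errors of
  order \<open>t\<close>. The perturbations and the transform \<open>g\<close> stay polynomial, so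
  only polynomials of \<open>S\<close> are ever evaluated.

  The quadratic inequality arises as follows. Let \<open>y\<close> be the unit vector along
  \<open>f(S) x\<close> and \<open>h = g - c\<close>. The norm of \<open>f(S) h(S) f(S) x\<close> is
  at most \<open>K\<close> alpha. The right factor \<open>f\<close> contributes \<open>K y\<close>,
  the left one, paired with \<open>y\<close>, contributes \<open>K x\<close>; hence <h(S) y, x> has
  modulus at most alpha / K. As \<open>c\<close> only multiplies an inner product of
  \<open>x\<close> and \<open>y\<close>, which vanishes, the bound 2 gives K <= 2 + alpha / K.

  Shrinking by \<open>r < 1\<close> keeps the resolvent bounded on the boundary curve; the final
  constant does not involve \<open>r\<close>.\<close>

lemma scaleC_one [simp]: "1 *\<^sub>C x = x"
  using scaleC_of_real[of 1 x] by simp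

lemma scaleC_zero_left [simp]: "0 *\<^sub>C x = 0"
  using scaleC_of_real[of 0 x] by simp

lemma scaleC_zero_right [simp]: "c *\<^sub>C 0 = 0"
  using scaleC_add_right[of c 0 0] by simp

lemma scaleC_minus_right [simp]: "c *\<^sub>C (- x) = - (c *\<^sub>C x)"
  using scaleC_add_right[of c x "- x"] by (simp add: eq_neg_iff_add_eq_0 add.commute)

lemma scaleC_minus_left [simp]: "(- c) *\<^sub>C x = - (c *\<^sub>C x)"
  using scaleC_add_left[of c "- c" x] scaleC_add_left[of 0 0 x]
  by (simp add: eq_neg_iff_add_eq_0 add.commute)

lemma scaleC_diff_right: "c *\<^sub>C (x - y) = c *\<^sub>C x - c *\<^sub>C y"
  using scaleC_add_right[of c x "- y"] by simp

lemma scaleC_diff_left: "(c - d) *\<^sub>C x = c *\<^sub>C x - d *\<^sub>C x"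
  using scaleC_add_left[of c "- d" x] by simp

lemma cinner_zero_left [simp]: "cinner 0 y = 0"
  using cinner_add_left[of 0 0 y] by simp

lemma cinner_minus_left [simp]: "cinner (- x) y = - cinner x y"
  by (rule minus_unique[symmetric]) (simp add: cinner_add_left[symmetric])

lemma cinner_diff_left: "cinner (x - y) z = cinner x z - cinner y z"
  using cinner_add_left[of x "- y" z] by simp

lemma cinner_add_right: "cinner x (y + z) = cinner x y + cinner x z"
  by (metis cinner_add_left cinner_commute complex_cnj_add)

lemma cinner_scaleC_right: "cinner x (c *\<^sub>C y) = cnj c * cinner x y"
  by (metis cinner_scaleC_left cinner_commute complex_cnj_mult)

lemma cinner_zero_right [simp]: "cinner x 0 = 0"
  using cinner_add_right[of x 0 0] by simp

lemma cinner_minus_right [simp]: "cinner x (- y) = - cinner x y"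
  by (rule minus_unique[symmetric]) (simp add: cinner_add_right[symmetric])

lemma cinner_diff_right: "cinner x (y - z) = cinner x y - cinner x z"
  using cinner_add_right[of x y "- z"] by simp

lemma norm_scaleC: "norm (c *\<^sub>C x) = norm c * norm x"
proof -
  have "complex_of_real ((norm (c *\<^sub>C x))\<^sup>2) = c * cnj c * cinner x x"
    by (simp only: cinner_self[symmetric] cinner_scaleC_left cinner_scaleC_right mult_ac)
  also have "\<dots> = complex_of_real ((norm c * norm x)\<^sup>2)"
    by (simp only: cinner_self complex_norm_square[symmetric] of_real_mult power_mult_distrib
        of_real_power)
  finally have "(norm (c *\<^sub>C x))\<^sup>2 = (norm c * norm x)\<^sup>2"
    by (simp only: of_real_eq_iff)
  thus ?thesis by simp
qed

lemma exists_phase: "\<exists>u. norm u = 1 \<and> u * z = complex_of_real (norm z)"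
proof (cases "z = 0")
  case False
  show ?thesis
    using False complex_norm_square[of z]
    by (intro exI[of _ "cnj z / of_real (norm z)"]) (auto simp: norm_divide field_simps power2_eq_square)
qed (auto intro: exI[of _ 1])

lemma norm_cinner_le: "norm (cinner x y) \<le> norm x * norm y"
proof -
  obtain u where u: "norm u = 1" "u * cinner x y = complex_of_real (norm (cinner x y))"
    using exists_phase by blast
  have "norm (cinner x y) = inner (u *\<^sub>C x) y"
    by (simp add: inner_eq_Re_cinner cinner_scaleC_left u)
  also have "\<dots> \<le> norm (u *\<^sub>C x) * norm y"
    by (rule norm_cauchy_schwarz)
  finally show ?thesis by (simp add: norm_scaleC u)
qed

lemma scaleC_scaleR: "c *\<^sub>C (r *\<^sub>R x) = r *\<^sub>R (c *\<^sub>C x)"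
  by (simp add: scaleC_of_real[symmetric] scaleC_scaleC mult.commute)

lemma cinner_scaleR_left: "cinner (r *\<^sub>R x) y = of_real r * cinner x y"
  by (simp add: cinner_scaleC_left flip: scaleC_of_real)

lemma
  assumes "bounded_clinear T"
  shows clinear_add: "T (x + y) = T x + T y"
    and clinear_scaleC: "T (c *\<^sub>C x) = c *\<^sub>C T x"
    and clinear_zero: "T 0 = 0"
    and clinear_diff: "T (x - y) = T x - T y"
    and clinear_scaleR: "T (r *\<^sub>R x) = r *\<^sub>R T x"
  using assms bounded_linear.axioms(1)[of T]
  by (auto simp: bounded_clinear_def linear_add linear_0 linear_diff linear_cmul)

section \<open>Polynomials in an operator\<close>

lemma op_poly_eq_sum:
  assumes "degree p \<le> n"
  shows "op_poly p T x = (\<Sum>i\<le>n. coeff p i *\<^sub>C (T ^^ i) x)"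
  unfolding op_poly_def
  using assms by (intro sum.mono_neutral_left) (auto simp: coeff_eq_0)

lemma op_poly_0 [simp]: "op_poly 0 T x = 0"
  by (simp add: op_poly_def)

text \<open>Horner step with \<open>T\<close> acting on the argument; this is why the inductions on
  polynomials below generalize over \<open>x\<close>.\<close>

lemma op_poly_pCons: "op_poly (pCons a p) T x = a *\<^sub>C x + op_poly p T (T x)"
proof -
  have "op_poly (pCons a p) T x = (\<Sum>i\<le>Suc (degree p). coeff (pCons a p) i *\<^sub>C (T ^^ i) x)"
    by (rule op_poly_eq_sum) (simp add: degree_pCons_le)
  also have "\<dots> = a *\<^sub>C x + op_poly p T (T x)"
    unfolding op_poly_def by (subst sum.atMost_Suc_shift) (simp add: funpow_Suc_right del: funpow.simps)
  finally show ?thesis .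
qed

lemma op_poly_add: "op_poly (p + q) T x = op_poly p T x + op_poly q T x"
proof -
  let ?n = "max (degree p) (degree q)"
  show ?thesis
    by (simp add: op_poly_eq_sum[of _ ?n] degree_add_le_max scaleC_add_left sum.distrib)
qed

lemma scaleC_sum_right: "c *\<^sub>C (\<Sum>i\<in>A. f i) = (\<Sum>i\<in>A. c *\<^sub>C f i)"
  by (induction A rule: infinite_finite_induct) (auto simp: scaleC_add_right)

lemma op_poly_smult: "op_poly (smult c p) T x = c *\<^sub>C op_poly p T x"
  by (simp add: op_poly_eq_sum[of _ "degree p"] scaleC_sum_right scaleC_scaleC)

lemma op_poly_minus: "op_poly (- p) T x = - op_poly p T x"
  using op_poly_smult[of "-1" p T x] by simp

lemma op_poly_diff: "op_poly (p - q) T x = op_poly p T x - op_poly q T x"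
  using op_poly_add[of p "- q" T x] by (simp add: op_poly_minus)

context
  fixes T :: "'a::complex_inner \<Rightarrow> 'a"
  assumes T: "bounded_clinear T"
begin

lemma op_poly_add_arg: "op_poly p T (x + y) = op_poly p T x + op_poly p T y"
  by (induction p arbitrary: x y)
    (simp_all add: op_poly_pCons clinear_add[OF T] scaleC_add_right algebra_simps)

lemma op_poly_scaleC_arg: "op_poly p T (c *\<^sub>C x) = c *\<^sub>C op_poly p T x"
  by (induction p arbitrary: x)
    (simp_all add: op_poly_pCons clinear_scaleC[OF T] scaleC_add_right scaleC_scaleC mult.commute)

lemma op_poly_commute: "op_poly p T (T x) = T (op_poly p T x)"
  by (induction p arbitrary: x)
    (simp_all add: op_poly_pCons clinear_scaleC[OF T] clinear_add[OF T] clinear_zero[OF T])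

lemma op_poly_mult: "op_poly (p * q) T x = op_poly p T (op_poly q T x)"
  by (induction p arbitrary: x)
    (simp_all add: op_poly_pCons op_poly_add op_poly_smult op_poly_commute)

lemma op_poly_scaleR_arg: "op_poly p T (r *\<^sub>R x) = r *\<^sub>R op_poly p T x"
  using op_poly_scaleC_arg[of p "of_real r" x] by (simp add: scaleC_of_real)

end

section \<open>Averages over the unit circle\<close>

text \<open>The period starts at -pi/2 so that pi/2 cuts it into the two half circles on which
  \<open>Re w\<close> has constant sign.\<close>

definition circle_mean :: "(complex \<Rightarrow> complex) \<Rightarrow> complex"
  where "circle_mean F = integral {- (pi / 2)..3 * pi / 2} (\<lambda>t. F (cis t)) / of_real (2 * pi)"

lemma continuous_on_circle:
  assumes "continuous_on (sphere 0 1) F"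
  shows "continuous_on A (\<lambda>t. F (cis t))"
  by (rule continuous_on_compose2[OF assms]) (auto intro!: continuous_intros)

lemma circle_integrable:
  fixes F :: "complex \<Rightarrow> 'b::euclidean_space"
  assumes "continuous_on (sphere 0 1) F"
  shows "(\<lambda>t. F (cis t)) integrable_on {c..d}"
  by (intro integrable_continuous_interval continuous_on_circle assms)

lemma circle_mean_cong:
  assumes "\<And>w. norm w = 1 \<Longrightarrow> F w = G w"
  shows "circle_mean F = circle_mean G"
  using assms by (simp add: circle_mean_def)

lemma circle_mean_add:
  assumes "continuous_on (sphere 0 1) F" "continuous_on (sphere 0 1) G"
  shows "circle_mean (\<lambda>w. F w + G w) = circle_mean F + circle_mean G"
  unfolding circle_mean_def
  by (simp add: integral_add circle_integrable assms add_divide_distrib)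

lemma circle_mean_diff:
  assumes "continuous_on (sphere 0 1) F" "continuous_on (sphere 0 1) G"
  shows "circle_mean (\<lambda>w. F w - G w) = circle_mean F - circle_mean G"
  unfolding circle_mean_def
  by (simp add: integral_diff circle_integrable assms diff_divide_distrib)

lemma circle_mean_mult_left: "circle_mean (\<lambda>w. c * F w) = c * circle_mean F"
  by (simp add: circle_mean_def)

lemma circle_mean_const: "circle_mean (\<lambda>w. c) = c"
  by (simp add: circle_mean_def scaleR_conv_of_real field_simps)

lemma circle_mean_cnj: "circle_mean (\<lambda>w. cnj (F w)) = cnj (circle_mean F)"
  by (simp add: circle_mean_def integral_cnj)

text \<open>Since dw = i w dt, this is a contour integral of \<open>f\<close> over a closed circle,
  and the closed disc is convex.\<close>

lemma circle_mean_Cauchy: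
  assumes "f holomorphic_on cball 0 1"
  shows "circle_mean (\<lambda>w. w * f w) = 0"
proof -
  let ?g = "part_circlepath 0 1 (- (pi / 2)) (3 * pi / 2)"
  have ends: "exp (\<i> * complex_of_real (3 * pi / 2)) = exp (\<i> * complex_of_real (- (pi / 2)))"
    using exp_plus_2pin[of "\<i> * complex_of_real (- (pi / 2))" 1] by (simp add: algebra_simps)
  have "(f has_contour_integral 0) ?g"
  proof (rule Cauchy_theorem_convex_simple[OF assms])
    show "path_image ?g \<subseteq> cball 0 1"
      by (rule order.trans[OF path_image_part_circlepath_subset sphere_cball]) auto
    show "pathfinish ?g = pathstart ?g"
      using ends by simp
  qed auto
  hence "((\<lambda>t. f (0 + of_real 1 * cis t) * of_real 1 * \<i> * cis t) has_integral 0) {- (pi / 2)..3 * pi / 2}"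
    by (subst (asm) has_contour_integral_part_circlepath_iff) auto
  from has_integral_mult_right[OF this, of "- \<i>"]
  have "((\<lambda>t. cis t * f (cis t)) has_integral 0) {- (pi / 2)..3 * pi / 2}"
    by (simp add: mult_ac)
  thus ?thesis
    by (simp add: circle_mean_def integral_unique)
qed

lemma circle_mean_power:
  "circle_mean (\<lambda>w. w ^ n) = (if n = 0 then 1 else 0)"
proof (cases n)
  case (Suc m)
  have "circle_mean (\<lambda>w. w * w ^ m) = 0"
    by (rule circle_mean_Cauchy) (auto intro!: holomorphic_intros)
  thus ?thesis using Suc by simp
qed (simp add: circle_mean_const)

lemma circle_mean_cnj_power:
  "circle_mean (\<lambda>w. cnj w ^ n) = (if n = 0 then 1 else 0)"
  using circle_mean_cnj[of "\<lambda>w. w ^ n"] by (simp add: circle_mean_power)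

lemma norm_circle_mean_le:
  assumes "continuous_on (sphere 0 1) F" "continuous_on (sphere 0 1) G"
    and "\<And>w. norm w = 1 \<Longrightarrow> norm (F w) \<le> G w"
  shows "norm (circle_mean F) \<le> integral {- (pi / 2)..3 * pi / 2} (\<lambda>t. G (cis t)) / (2 * pi)"
proof -
  have "norm (integral {- (pi / 2)..3 * pi / 2} (\<lambda>t. F (cis t)))
      \<le> integral {- (pi / 2)..3 * pi / 2} (\<lambda>t. G (cis t))"
    by (intro integral_norm_bound_integral circle_integrable assms) (auto intro: assms)
  thus ?thesis
    by (simp add: circle_mean_def norm_divide divide_right_mono)
qed

lemma circle_mean_of_real:
  assumes "continuous_on (sphere 0 1) G"
  shows "circle_mean (\<lambda>w. complex_of_real (G w))
    = of_real (integral {- (pi / 2)..3 * pi / 2} (\<lambda>t. G (cis t)) / (2 * pi))"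
proof -
  have "((\<lambda>t. G (cis t)) has_integral integral {- (pi / 2)..3 * pi / 2} (\<lambda>t. G (cis t)))
      {- (pi / 2)..3 * pi / 2}"
    by (intro integrable_integral circle_integrable assms)
  from has_integral_linear[OF this bounded_linear_of_real]
  have "integral {- (pi / 2)..3 * pi / 2} (\<lambda>t. complex_of_real (G (cis t)))
      = of_real (integral {- (pi / 2)..3 * pi / 2} (\<lambda>t. G (cis t)))"
    unfolding o_def by (rule integral_unique)
  thus ?thesis by (simp add: circle_mean_def)
qed

lemma norm_circle_mean_le_const:
  assumes "continuous_on (sphere 0 1) F" "\<And>w. norm w = 1 \<Longrightarrow> norm (F w) \<le> B"
  shows "norm (circle_mean F) \<le> B"
  using norm_circle_mean_le[OF assms(1), of "\<lambda>_. B"] assms(2)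
  by (simp add: measure_lborel_Icc)

section \<open>The Poisson kernel\<close>

lemma cnj_eq_inverse_unit: "norm w = 1 \<Longrightarrow> w * cnj w = 1"
  by (simp add: complex_norm_square[symmetric])

context
  fixes q :: real
  assumes q: "\<bar>q\<bar> < 1"
begin

text \<open>On the unit circle the denominator is |1 - q w|^2. Negative \<open>q\<close> is allowed;
  it belongs to ellipses whose vertical axis is the longer one.\<close>

definition poisson :: "complex \<Rightarrow> real"
  where "poisson w = (1 - q\<^sup>2) / (1 + q\<^sup>2 - 2 * q * Re w)"

lemma poisson_denom_pos:
  assumes "norm w = 1"
  shows "1 + q\<^sup>2 - 2 * q * Re w > 0"
proof -
  have "q * Re w \<le> \<bar>q\<bar> * 1"
  proof -
    have "\<bar>q\<bar> * \<bar>Re w\<bar> \<le> \<bar>q\<bar> * 1"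
      using abs_Re_le_cmod[of w] assms by (intro mult_left_mono) auto
    thus ?thesis
      using abs_ge_self[of "q * Re w"] by (simp add: abs_mult)
  qed
  moreover have "0 < (1 - \<bar>q\<bar>)\<^sup>2"
    using q by simp
  moreover have "(1 - \<bar>q\<bar>)\<^sup>2 = 1 + q\<^sup>2 - 2 * \<bar>q\<bar>"
    by (simp add: power2_diff)
  ultimately show ?thesis by linarith
qed

lemma one_minus_qw_nz:
  fixes w :: complex
  assumes "norm w \<le> 1"
  shows "1 - of_real q * w \<noteq> 0"
proof
  assume "1 - of_real q * w = 0"
  hence "of_real q * w = 1" by simp
  hence "norm (of_real q * w) = 1" by (simp only: norm_one)
  moreover have "norm (of_real q * w) \<le> \<bar>q\<bar> * 1"
    using assms by (simp add: norm_mult mult_left_le)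
  ultimately show False using q by simp
qed

lemma continuous_on_poisson: "continuous_on (sphere 0 1) poisson"
  unfolding poisson_def
  by (intro continuous_intros) (use poisson_denom_pos in fastforce)

text \<open>Splits the kernel into a holomorphic part and the conjugate of a holomorphic part
  vanishing at 0, so that Cauchy's theorem gives its Fourier coefficients.\<close>

lemma poisson_eq:
  assumes "norm w = 1"
  shows "complex_of_real (poisson w)
    = 1 / (1 - of_real q * w) + cnj (of_real q * w * (1 / (1 - of_real q * w)))"
proof -
  let ?D = "(1 - of_real q * w) * (1 - of_real q * cnj w)"
  have D: "?D = of_real (1 + q\<^sup>2 - 2 * q * Re w)"
  proof -
    have "?D = 1 + of_real (q\<^sup>2) * (w * cnj w) - of_real q * (w + cnj w)"
      by (simp add: algebra_simps power2_eq_square)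
    thus ?thesis
      unfolding cnj_eq_inverse_unit[OF assms] complex_add_cnj by simp
  qed
  have "1 - of_real q * w \<noteq> 0" "1 - of_real q * cnj w \<noteq> 0"
    using one_minus_qw_nz[of w] one_minus_qw_nz[of "cnj w"] assms by auto
  hence "1 / (1 - of_real q * w) + cnj (of_real q * w * (1 / (1 - of_real q * w)))
      = ((1 - of_real q * cnj w) + of_real q * cnj w * (1 - of_real q * w)) / ?D"
    by (simp add: divide_simps)
  also have "\<dots> = (1 - of_real (q\<^sup>2) * (w * cnj w)) / ?D"
    by (simp add: algebra_simps power2_eq_square)
  also have "\<dots> = of_real (poisson w)"
    by (simp only: D cnj_eq_inverse_unit[OF assms] poisson_def) simp
  finally show ?thesis by simp
qed

text \<open>The mean is the \<open>n\<close>-th Taylor coefficient of 1 / (1 - q w). The identity N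
  = 1 + q w N shifts coefficients, which replaces an interchange of series and integral.\<close>

lemma circle_mean_cnj_power_geometric:
  "circle_mean (\<lambda>w. cnj w ^ n * (1 / (1 - of_real q * w))) = of_real q ^ n"
proof -
  define N where "N = (\<lambda>w. 1 / (1 - complex_of_real q * w))"
  have hol: "N holomorphic_on cball 0 1"
    unfolding N_def using one_minus_qw_nz by (intro holomorphic_intros) auto
  have cont: "continuous_on (sphere 0 1) N"
    by (rule continuous_on_subset[OF holomorphic_on_imp_continuous_on[OF hol]]) auto
  have N: "N w = 1 + w * (of_real q * N w)" if "norm w = 1" for w
    using one_minus_qw_nz[of w] that by (simp add: N_def field_simps)
  have "circle_mean (\<lambda>w. cnj w ^ n * N w) = of_real q ^ n"
  proof (induction n)
    case 0
    have "circle_mean N = circle_mean (\<lambda>w. 1 + w * (of_real q * N w))"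
      using N by (intro circle_mean_cong) auto
    also have "\<dots> = circle_mean (\<lambda>w. 1) + circle_mean (\<lambda>w. w * (of_real q * N w))"
      by (intro circle_mean_add continuous_intros cont)
    also have "\<dots> = 1"
      using circle_mean_Cauchy[of "\<lambda>w. of_real q * N w"] hol
      by (simp add: circle_mean_const holomorphic_intros)
    finally show ?case by simp
  next
    case (Suc n)
    have "circle_mean (\<lambda>w. cnj w ^ Suc n * N w)
        = circle_mean (\<lambda>w. cnj w ^ Suc n + of_real q * (cnj w ^ n * N w))"
    proof (rule circle_mean_cong)
      fix w :: complex assume w: "norm w = 1"
      have "cnj w ^ Suc n * N w = cnj w ^ Suc n + (w * cnj w) * (of_real q * (cnj w ^ n * N w))"
        by (subst N[OF w]) (simp add: algebra_simps)
      thus "cnj w ^ Suc n * N w = cnj w ^ Suc n + of_real q * (cnj w ^ n * N w)"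
        by (simp only: cnj_eq_inverse_unit[OF w] mult_1)
    qed
    also have "\<dots> = circle_mean (\<lambda>w. cnj w ^ Suc n) + of_real q * circle_mean (\<lambda>w. cnj w ^ n * N w)"
      unfolding circle_mean_mult_left[symmetric]
      by (intro circle_mean_add continuous_intros cont)
    finally show ?case
      by (simp only: Suc circle_mean_cnj_power) simp
  qed
  thus ?thesis by (simp add: N_def)
qed

text \<open>Against \<open>cnj w ^ n\<close>, the second half of \<open>poisson_eq\<close> becomes
  the conjugate of a holomorphic function vanishing at 0 and drops out. The other moments follow by
  conjugation, the kernel being real.\<close>

lemma
  shows circle_mean_power_poisson:
      "circle_mean (\<lambda>w. w ^ n * of_real (poisson w)) = of_real q ^ n"
    and circle_mean_cnj_power_poisson:
      "circle_mean (\<lambda>w. cnj w ^ n * of_real (poisson w)) = of_real q ^ n"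
proof -
  define N where "N = (\<lambda>w. 1 / (1 - complex_of_real q * w))"
  have hol: "N holomorphic_on cball 0 1"
    unfolding N_def using one_minus_qw_nz by (intro holomorphic_intros) auto
  have cont: "continuous_on (sphere 0 1) N"
    by (rule continuous_on_subset[OF holomorphic_on_imp_continuous_on[OF hol]]) auto
  have "circle_mean (\<lambda>w. cnj w ^ n * of_real (poisson w))
      = circle_mean (\<lambda>w. cnj w ^ n * N w + cnj (w * (w ^ n * of_real q * N w)))"
    by (intro circle_mean_cong) (simp add: poisson_eq N_def ring_distribs mult_ac)
  also have "\<dots> = circle_mean (\<lambda>w. cnj w ^ n * N w) + circle_mean (\<lambda>w. cnj (w * (w ^ n * of_real q * N w)))"
    by (intro circle_mean_add continuous_intros cont)
  also have "circle_mean (\<lambda>w. cnj (w * (w ^ n * of_real q * N w))) = 0"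
    unfolding circle_mean_cnj by (subst circle_mean_Cauchy) (auto intro!: holomorphic_intros hol)
  finally show 1: "circle_mean (\<lambda>w. cnj w ^ n * of_real (poisson w)) = of_real q ^ n"
    using circle_mean_cnj_power_geometric[of n] by (simp add: N_def)
  show "circle_mean (\<lambda>w. w ^ n * of_real (poisson w)) = of_real q ^ n"
    using circle_mean_cnj[of "\<lambda>w. cnj w ^ n * of_real (poisson w)"] 1 by simp
qed

end

context
  fixes q :: real
  assumes q: "\<bar>q\<bar> < 1"
begin

text \<open>The arctangent is -arg (1 - q w) at \<open>w = cis t\<close>, and the kernel equals 1 +
  2 Re (q w / (1 - q w)).\<close>

lemma poisson_antiderivative:
  "((\<lambda>t. t + 2 * arctan (q * sin t / (1 - q * cos t))) has_real_derivative poisson q (cis t)) (at t within A)"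
proof -
  have c: "q * cos t < 1"
  proof -
    have "q * cos t \<le> \<bar>q\<bar> * 1"
      by (rule order.trans[OF abs_ge_self]) (simp add: abs_mult mult_left_le)
    thus ?thesis using q by simp
  qed
  define u where "u = 1 - q * cos t"
  have u: "u > 0" using c by (simp add: u_def)
  have sc: "(sin t)\<^sup>2 = 1 - (cos t)\<^sup>2"
    by (simp add: sin_squared_eq)
  have e: "u\<^sup>2 + (q * sin t)\<^sup>2 = 1 + q\<^sup>2 - 2 * q * cos t"
    unfolding u_def power_mult_distrib sc by (simp add: power2_eq_square algebra_simps)
  have D: "1 + q\<^sup>2 - 2 * q * cos t > 0"
    using poisson_denom_pos[OF q, of "cis t"] by simp
  have "((\<lambda>t. t + 2 * arctan (q * sin t / (1 - q * cos t))) has_real_derivative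
      1 + 2 * (inverse (1 + (q * sin t / u)\<^sup>2) * ((q * cos t * u - q * sin t * (q * sin t)) / (u * u)))) (at t within A)"
    using u unfolding u_def by (auto intro!: derivative_eq_intros)
  also have "inverse (1 + (q * sin t / u)\<^sup>2) * ((q * cos t * u - q * sin t * (q * sin t)) / (u * u))
      = (q * cos t * u - q * sin t * (q * sin t)) / (u\<^sup>2 + (q * sin t)\<^sup>2)"
  proof -
    have "1 + (q * sin t / u)\<^sup>2 = (u\<^sup>2 + (q * sin t)\<^sup>2) / u\<^sup>2"
      using u by (simp only: power_divide) (simp add: add_divide_distrib)
    thus ?thesis
      using u by (simp add: power2_eq_square)
  qed
  also have "q * cos t * u - q * sin t * (q * sin t) = q * cos t - q\<^sup>2 * ((sin t)\<^sup>2 + (cos t)\<^sup>2)"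
    unfolding u_def by algebra
  also have "1 + 2 * ((q * cos t - q\<^sup>2 * ((sin t)\<^sup>2 + (cos t)\<^sup>2)) / (u\<^sup>2 + (q * sin t)\<^sup>2)) = poisson q (cis t)"
    unfolding e sin_cos_squared_add using D by (simp add: poisson_def[OF q] field_simps)
  finally show ?thesis .
qed

lemma integral_poisson:
  assumes "c \<le> d"
  shows "integral {c..d} (\<lambda>t. poisson q (cis t)) = (d + 2 * arctan (q * sin d / (1 - q * cos d)))
     - (c + 2 * arctan (q * sin c / (1 - q * cos c)))"
  by (intro integral_unique fundamental_theorem_of_calculus assms)
    (auto simp flip: has_real_derivative_iff_has_vector_derivative intro: poisson_antiderivative)

text \<open>Subtracting \<open>(1 - q\<^sup>2) / (1 + q\<^sup>2)\<close> makes the kernel change sign exactly at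
  \<open>\<plusminus>\<i>\<close>, so that its total variation is computed on the two half circles.\<close>

lemma poisson_L1_norm:
  "integral {- (pi / 2)..3 * pi / 2} (\<lambda>t. \<bar>poisson q (cis t) - (1 - q\<^sup>2) / (1 + q\<^sup>2)\<bar>) / (2 * pi)
     = 4 / pi * arctan \<bar>q\<bar>"
proof -
  define k where "k = (\<lambda>t. poisson q (cis t) - (1 - q\<^sup>2) / (1 + q\<^sup>2))"
  define m where "m = (1 - q\<^sup>2) / (1 + q\<^sup>2)"
  have cont: "continuous_on A k" for A
    unfolding k_def by (intro continuous_intros continuous_on_circle continuous_on_poisson[OF q])
  have int: "k integrable_on {c..d}" "(\<lambda>t. \<bar>k t\<bar>) integrable_on {c..d}" for c d
    by (intro integrable_continuous_interval continuous_intros cont)+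
  have q2: "q\<^sup>2 < 1" using q by (simp add: abs_square_less_1)
  have keq: "k t = cos t * q * (2 * (1 - q\<^sup>2) / ((1 + q\<^sup>2) * (1 + q\<^sup>2 - 2 * q * cos t)))" for t
  proof -
    define D where "D = 1 + q\<^sup>2 - 2 * q * cos t"
    define E where "E = 1 + q\<^sup>2"
    have nz: "D \<noteq> 0" "E \<noteq> 0"
      using poisson_denom_pos[OF q, of "cis t"] by (auto simp: D_def E_def add_nonneg_eq_0_iff)
    have "k t = (1 - q\<^sup>2) / D - (1 - q\<^sup>2) / E"
      by (simp add: k_def poisson_def[OF q] D_def E_def)
    also have "\<dots> = (1 - q\<^sup>2) * (E - D) / (E * D)"
      using nz by (simp add: field_simps)
    also have "E - D = 2 * q * cos t"
      by (simp add: D_def E_def)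
    finally show ?thesis by (simp add: D_def E_def)
  qed
  have pos: "2 * (1 - q\<^sup>2) / ((1 + q\<^sup>2) * (1 + q\<^sup>2 - 2 * q * cos t)) \<ge> 0" for t
    using poisson_denom_pos[OF q, of "cis t"] q2 by simp
  \<comment> \<open>By \<open>keq\<close> the sign of \<open>k t\<close> is that of
    \<open>q * cos t\<close>; \<open>s\<close> is the sign of the cosine on the half circle.\<close>
  have absint: "integral {c..d} (\<lambda>t. \<bar>k t\<bar>) = sgn q * s * integral {c..d} k"
    if "s \<in> {-1, 1}" "\<And>t. t \<in> {c..d} \<Longrightarrow> s * cos t \<ge> 0" for c d s
  proof -
    have "\<bar>k t\<bar> = (sgn q * s) * k t" if "t \<in> {c..d}" for t
    proof -
      have "\<bar>cos t\<bar> = s * cos t"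
        using \<open>s \<in> {-1, 1}\<close> \<open>t \<in> {c..d} \<Longrightarrow> s * cos t \<ge> 0\<close> that by auto
      thus ?thesis
        unfolding keq abs_mult abs_of_nonneg[OF pos] by (simp add: abs_sgn[of q])
    qed
    hence "integral {c..d} (\<lambda>t. \<bar>k t\<bar>) = integral {c..d} (\<lambda>t. (sgn q * s) * k t)"
      by (intro integral_cong) auto
    thus ?thesis by simp
  qed
  have intk: "integral {c..d} k = integral {c..d} (\<lambda>t. poisson q (cis t)) - (d - c) * m" if "c \<le> d" for c d
    unfolding k_def m_def[symmetric] using that
    by (subst integral_diff) (auto intro: circle_integrable continuous_on_poisson[OF q])
  have s3: "sin (3 * pi / 2) = -1" "cos (3 * pi / 2) = 0"
    using sin_periodic[of "- (pi / 2)"] cos_periodic[of "- (pi / 2)"]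
    by (simp_all add: algebra_simps)
  have right: "integral {- (pi / 2)..pi / 2} k = pi + 4 * arctan q - pi * m"
    by (subst intk) (auto simp: integral_poisson arctan_minus)
  have left: "integral {pi / 2..3 * pi / 2} k = pi - 4 * arctan q - pi * m"
    by (subst intk) (auto simp: integral_poisson arctan_minus s3)
  have cosneg: "- 1 * cos t \<ge> 0" if "t \<in> {pi / 2..3 * pi / 2}" for t
    using cos_ge_zero[of "t - pi"] that by simp
  have "integral {- (pi / 2)..3 * pi / 2} (\<lambda>t. \<bar>k t\<bar>)
      = integral {- (pi / 2)..pi / 2} (\<lambda>t. \<bar>k t\<bar>) + integral {pi / 2..3 * pi / 2} (\<lambda>t. \<bar>k t\<bar>)"
    by (rule Henstock_Kurzweil_Integration.integral_combine[symmetric]) (auto intro: int)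
  also have "\<dots> = sgn q * 1 * integral {- (pi / 2)..pi / 2} k + sgn q * (-1) * integral {pi / 2..3 * pi / 2} k"
    using cosneg cos_ge_zero by (intro arg_cong2[of _ _ _ _ "(+)"] absint) auto
  \<comment> \<open>The two halves enter with opposite signs, so the terms with \<open>pi\<close>
    and \<open>m\<close> cancel and only the arctangents remain.\<close>
  also have "\<dots> = 8 * (sgn q * arctan q)"
    unfolding left right by (simp add: algebra_simps)
  also have "sgn q * arctan q = arctan \<bar>q\<bar>"
    by (cases q "0 :: real" rule: linorder_cases) (auto simp: arctan_minus)
  finally show ?thesis by (simp add: k_def)
qed

end

section \<open>Faber polynomials of an ellipse\<close>

text \<open>The parameters are the coefficients of a Joukowski map; \<open>be\<close> is signed, so
  neither half axis has to be the longer one.\<close>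

locale ellipse_param =
  fixes al be :: real
  assumes al_be: "\<bar>be\<bar> < al"
begin

definition q :: real where "q = be / al"

text \<open>The boundary of the ellipse with half axes \<open>al + be\<close> and \<open>al - be\<close>, traversed clockwise.
  In terms of the exterior Riemann map \<open>\<psi> w = al * w + be / w\<close> this is \<open>\<psi> (cnj s)\<close>, so that
  expansions at infinity become power series in \<open>s\<close>.\<close>

definition bdry :: "complex \<Rightarrow> complex" where "bdry s = of_real al * cnj s + of_real be * s"

lemma al_pos: "al > 0"
  using al_be by linarith

lemma abs_q: "\<bar>q\<bar> < 1"
  using al_be al_pos by (simp add: q_def abs_divide)

lemma al_q: "al * q = be"
  using al_pos by (simp add: q_def)

lemma continuous_on_bdry [continuous_intros]:
  "continuous_on A f \<Longrightarrow> continuous_on A (\<lambda>x. bdry (f x))"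
  unfolding bdry_def by (intro continuous_intros)

text \<open>With \<open>F\<^sub>n\<close> the usual Faber polynomials this is \<open>2, F\<^sub>1, F\<^sub>2, \<dots>\<close>. Doubling \<open>F\<^sub>0 = 1\<close> makes
  the recurrence and the boundary values uniform in \<open>n\<close>.\<close>

fun faber :: "nat \<Rightarrow> complex poly" where
  "faber 0 = [:2:]"
| "faber (Suc 0) = [:0, of_real (1 / al):]"
| "faber (Suc (Suc n)) = smult (of_real (1 / al)) (pCons 0 (faber (Suc n)) - smult (of_real be) (faber n))"

text \<open>The Chebyshev identity: with w = \<open>cnj s\<close> = 1/s, the functions w^n + q^n
  w^(-n) obey the recurrence that defines \<open>faber\<close>.\<close>

lemma poly_faber_bdry:
  assumes "norm s = 1"
  shows "poly (faber n) (bdry s) = cnj s ^ n + of_real q ^ n * s ^ n"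
proof (induction n rule: faber.induct)
  case 2
  show ?case
    using al_pos al_q by (simp add: bdry_def field_simps flip: of_real_mult)
next
  case (3 n)
  have ss: "s * cnj s = 1"
    by (rule cnj_eq_inverse_unit[OF assms])
  have be: "complex_of_real be = of_real al * of_real q"
    by (simp add: al_q flip: of_real_mult)
  have "of_real al * poly (faber (Suc (Suc n))) (bdry s)
      = bdry s * poly (faber (Suc n)) (bdry s) - of_real be * poly (faber n) (bdry s)"
    using al_pos by simp
  \<comment> \<open>The last summand vanishes on the unit circle; spelling it out turns the step
    into a polynomial identity in \<open>s\<close> and \<open>cnj s\<close>.\<close>
  also have "\<dots> = of_real al * (cnj s ^ Suc (Suc n) + of_real q ^ Suc (Suc n) * s ^ Suc (Suc n))
      + of_real al * of_real q * (cnj s ^ n + of_real q ^ n * s ^ n) * (s * cnj s - 1)"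
    unfolding 3 unfolding bdry_def be by (simp add: algebra_simps)
  finally show ?case
    using al_pos ss by simp
qed auto

text \<open>Spanning is encoded as a closure in order to obtain \<open>faber_induct\<close>: a
  property stable under sums and scalar multiples is checked on Faber polynomials only.\<close>

inductive faber_span :: "complex poly \<Rightarrow> bool" where
  faber: "faber_span (faber n)"
| add: "faber_span p \<Longrightarrow> faber_span r \<Longrightarrow> faber_span (p + r)"
| smult: "faber_span p \<Longrightarrow> faber_span (smult c p)"

lemma faber_span_pCons_0: "faber_span p \<Longrightarrow> faber_span (pCons 0 p)"
proof (induction rule: faber_span.induct)
  case (faber n)
  show ?case
  proof (cases n)
    case 0
    have "pCons 0 (faber 0) = smult (2 * of_real al) (faber 1)"
      using al_pos by simp
    thus ?thesis using 0 faber_span.intros by metis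
  next
    case (Suc m)
    have "pCons 0 (faber (Suc m)) = smult (of_real al) (faber (Suc (Suc m))) + smult (of_real be) (faber m)"
      using al_pos by simp
    thus ?thesis using Suc faber_span.intros by metis
  qed
next
  case (add p r)
  thus ?case using faber_span.add[OF add.IH] by simp
next
  case (smult p c)
  thus ?case using faber_span.smult[OF smult.IH, of c] by simp
qed

lemma faber_span: "faber_span p"
proof (induction p)
  case 0
  show ?case using faber_span.smult[OF faber_span.faber, of 0 0] by simp
next
  case (pCons a p)
  have "pCons a p = smult (a / 2) (faber 0) + pCons 0 p"
    by simp
  thus ?case
    using pCons.IH faber_span_pCons_0 faber_span.intros by metis
qed

lemma faber_induct [case_names faber add smult]:
  assumes "\<And>n. Q (faber n)" "\<And>p r. Q p \<Longrightarrow> Q r \<Longrightarrow> Q (p + r)" "\<And>c p. Q p \<Longrightarrow> Q (smult c p)"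
  shows "Q p"
  using faber_span[of p] by (induction rule: faber_span.induct) (auto intro: assms)

text \<open>Up to a constant factor the second factor is the derivative of the boundary curve, so
  this is Cauchy's theorem for \<open>p\<close> on the ellipse. Among Faber polynomials only n = 1
  leaves nonzero terms, which cancel by \<open>al * q = be\<close>.\<close>

lemma circle_mean_bdry_derivative:
  "circle_mean (\<lambda>s. poly p (bdry s) * (of_real al * cnj s - of_real be * s)) = 0"
proof (induction p rule: faber_induct)
  case (faber n)
  have *: "circle_mean (\<lambda>s. poly (faber n) (bdry s) * (of_real al * cnj s - of_real be * s))
     = circle_mean (\<lambda>s. of_real al * cnj s ^ Suc n + of_real (al * q ^ n) * (s ^ n * cnj s)
         - of_real be * (cnj s ^ n * s) - of_real (be * q ^ n) * s ^ Suc n)"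
    by (rule circle_mean_cong) (simp add: poly_faber_bdry algebra_simps)
  also have "\<dots> = of_real al * circle_mean (\<lambda>s. cnj s ^ Suc n)
      + of_real (al * q ^ n) * circle_mean (\<lambda>s. s ^ n * cnj s)
      - of_real be * circle_mean (\<lambda>s. cnj s ^ n * s)
      - of_real (be * q ^ n) * circle_mean (\<lambda>s. s ^ Suc n)"
    by (subst circle_mean_add circle_mean_diff; (intro continuous_intros)?)+
      (simp only: circle_mean_mult_left)
  also have "circle_mean (\<lambda>s. s ^ n * cnj s) = (if n = 1 then 1 else 0)"
  proof (cases n)
    case 0
    thus ?thesis using circle_mean_cnj_power[of 1] by simp
  next
    case (Suc m)
    have "circle_mean (\<lambda>s. s ^ n * cnj s) = circle_mean (\<lambda>s. s ^ m)"
      unfolding Suc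
    proof (rule circle_mean_cong)
      fix s :: complex assume "norm s = 1"
      have "s ^ Suc m * cnj s = s ^ m * (s * cnj s)" by (simp add: mult_ac)
      thus "s ^ Suc m * cnj s = s ^ m"
        by (simp only: cnj_eq_inverse_unit[OF \<open>norm s = 1\<close>] mult_1_right)
    qed
    thus ?thesis using Suc by (simp add: circle_mean_power)
  qed
  also have "circle_mean (\<lambda>s. cnj s ^ n * s) = cnj (circle_mean (\<lambda>s. s ^ n * cnj s))"
    by (simp flip: circle_mean_cnj)
  also have "circle_mean (\<lambda>s. s ^ n * cnj s) = (if n = 1 then 1 else 0)"
    by fact
  finally show ?case
    using al_q by (auto simp: circle_mean_power circle_mean_cnj_power
        simp del: power_Suc faber.simps simp flip: of_real_mult)
next
  case (add p r)
  thus ?case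
    by (simp add: distrib_right circle_mean_add continuous_intros)
next
  case (smult c p)
  thus ?case
    by (simp add: mult.assoc circle_mean_mult_left)
qed

text \<open>\<open>g\<close> is the Cauchy transform of the conjugate of \<open>f\<close>: on the boundary the two differ by a function
  which extends holomorphically to the exterior and vanishes at infinity. The second part
  expresses \<open>g\<close> by the double layer potential of \<open>f\<close>, whose kernel on an ellipse is a Poisson
  kernel at radius \<open>q\<close>.\<close>

definition cauchy_conj :: "complex poly \<Rightarrow> complex poly \<Rightarrow> bool" where
  "cauchy_conj f g \<longleftrightarrow>
     (\<exists>p. \<forall>s. norm s = 1 \<longrightarrow> poly g (bdry s) = cnj (poly f (bdry s)) + s * poly p s) \<and>
     (\<exists>m. \<forall>z. norm z = 1 \<longrightarrow> circle_mean (\<lambda>w. poly f (bdry (cnj z * w))) = m \<and>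
        cnj (poly g (bdry z)) = circle_mean (\<lambda>w. poly f (bdry (cnj z * w)) * of_real (poisson q w)))"

lemma continuous_on_poisson_of_real [continuous_intros]:
  "continuous_on (sphere 0 1) (\<lambda>w. complex_of_real (poisson q w))"
  by (intro continuous_intros continuous_on_poisson abs_q)

text \<open>The factor q^n matches the coefficients of \<open>cnj s ^ n\<close> and leaves (q^(2n) -
  1) s^n, which is divisible by \<open>s\<close> unless n = 0, where it is zero. In the second part
  the same factor arises as the \<open>n\<close>-th moment of the Poisson kernel.\<close>

lemma cauchy_conj_faber: "cauchy_conj (faber n) (smult (of_real q ^ n) (faber n))"
  unfolding cauchy_conj_def
proof (intro conjI exI allI impI)
  fix s :: complex assume s: "norm s = 1"
  let ?p = "if n = 0 then 0 else monom (of_real (q ^ n * q ^ n - 1)) (n - 1)"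
  show "poly (smult (of_real q ^ n) (faber n)) (bdry s) = cnj (poly (faber n) (bdry s)) + s * poly ?p s"
    by (cases n) (simp_all add: poly_faber_bdry[OF s] poly_monom algebra_simps
        del: faber.simps)
next
  fix z :: complex assume z: "norm z = 1"
  have f: "poly (faber n) (bdry (cnj z * w)) = z ^ n * cnj w ^ n + of_real q ^ n * cnj z ^ n * w ^ n"
    if "norm w = 1" for w
    using that z by (subst poly_faber_bdry) (auto simp: norm_mult power_mult_distrib)
  have "circle_mean (\<lambda>w. poly (faber n) (bdry (cnj z * w)))
      = circle_mean (\<lambda>w. z ^ n * cnj w ^ n + of_real q ^ n * cnj z ^ n * w ^ n)"
    using f by (rule circle_mean_cong)
  also have "\<dots> = z ^ n * circle_mean (\<lambda>w. cnj w ^ n) + of_real q ^ n * cnj z ^ n * circle_mean (\<lambda>w. w ^ n)"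
    by (subst circle_mean_add) (auto intro!: continuous_intros simp: circle_mean_mult_left)
  also have "\<dots> = (if n = 0 then 2 else 0)"
    by (simp add: circle_mean_power circle_mean_cnj_power)
  finally show "circle_mean (\<lambda>w. poly (faber n) (bdry (cnj z * w))) = (if n = 0 then 2 else 0)" .
  have "circle_mean (\<lambda>w. poly (faber n) (bdry (cnj z * w)) * of_real (poisson q w))
      = circle_mean (\<lambda>w. z ^ n * (cnj w ^ n * of_real (poisson q w))
          + of_real q ^ n * cnj z ^ n * (w ^ n * of_real (poisson q w)))"
    using f by (intro circle_mean_cong) (simp add: ring_distribs mult_ac)
  also have "\<dots> = z ^ n * circle_mean (\<lambda>w. cnj w ^ n * of_real (poisson q w))
      + of_real q ^ n * cnj z ^ n * circle_mean (\<lambda>w. w ^ n * of_real (poisson q w))"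
    by (subst circle_mean_add) (auto intro!: continuous_intros simp: circle_mean_mult_left)
  also have "\<dots> = cnj (poly (smult (of_real q ^ n) (faber n)) (bdry z))"
    by (simp add: circle_mean_power_poisson circle_mean_cnj_power_poisson abs_q
        poly_faber_bdry[OF z] algebra_simps)
  finally show "cnj (poly (smult (of_real q ^ n) (faber n)) (bdry z))
      = circle_mean (\<lambda>w. poly (faber n) (bdry (cnj z * w)) * of_real (poisson q w))" ..
qed

lemma cauchy_conj_add:
  assumes "cauchy_conj f g" "cauchy_conj f' g'"
  shows "cauchy_conj (f + f') (g + g')"
proof -
  obtain p m where 1: "\<forall>s. norm s = 1 \<longrightarrow> poly g (bdry s) = cnj (poly f (bdry s)) + s * poly p s"
      "\<forall>z. norm z = 1 \<longrightarrow> circle_mean (\<lambda>w. poly f (bdry (cnj z * w))) = m \<and>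
        cnj (poly g (bdry z)) = circle_mean (\<lambda>w. poly f (bdry (cnj z * w)) * of_real (poisson q w))"
    using assms(1) unfolding cauchy_conj_def by (elim conjE exE)
  obtain p' m' where 2: "\<forall>s. norm s = 1 \<longrightarrow> poly g' (bdry s) = cnj (poly f' (bdry s)) + s * poly p' s"
      "\<forall>z. norm z = 1 \<longrightarrow> circle_mean (\<lambda>w. poly f' (bdry (cnj z * w))) = m' \<and>
        cnj (poly g' (bdry z)) = circle_mean (\<lambda>w. poly f' (bdry (cnj z * w)) * of_real (poisson q w))"
    using assms(2) unfolding cauchy_conj_def by (elim conjE exE)
  have cont: "continuous_on (sphere 0 1) (\<lambda>w. poly f (bdry (cnj z * w)) * of_real (poisson q w))" for f z
    by (intro continuous_intros)
  show ?thesis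
    unfolding cauchy_conj_def
  proof (intro conjI exI[of _ "p + p'"] exI[of _ "m + m'"] allI impI)
    fix z :: complex assume "norm z = 1"
    show "poly (g + g') (bdry z) = cnj (poly (f + f') (bdry z)) + z * poly (p + p') z"
      using 1(1) 2(1) \<open>norm z = 1\<close> by (simp add: distrib_left)
  qed (simp_all add: 1(2) 2(2) distrib_right circle_mean_add cont continuous_intros)
qed

lemma cauchy_conj_smult:
  assumes "cauchy_conj f g"
  shows "cauchy_conj (smult c f) (smult (cnj c) g)"
proof -
  obtain p m where 1: "\<forall>s. norm s = 1 \<longrightarrow> poly g (bdry s) = cnj (poly f (bdry s)) + s * poly p s"
      "\<forall>z. norm z = 1 \<longrightarrow> circle_mean (\<lambda>w. poly f (bdry (cnj z * w))) = m \<and>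
        cnj (poly g (bdry z)) = circle_mean (\<lambda>w. poly f (bdry (cnj z * w)) * of_real (poisson q w))"
    using assms unfolding cauchy_conj_def by (elim conjE exE)
  show ?thesis
    unfolding cauchy_conj_def
  proof (intro conjI exI[of _ "smult (cnj c) p"] exI[of _ "c * m"] allI impI)
    fix z :: complex assume "norm z = 1"
    show "poly (smult (cnj c) g) (bdry z) = cnj (poly (smult c f) (bdry z)) + z * poly (smult (cnj c) p) z"
      using 1(1) \<open>norm z = 1\<close> by (simp add: distrib_left mult.left_commute)
  qed (simp_all add: 1(2) mult.assoc circle_mean_mult_left)
qed

lemma ex_cauchy_conj: "\<exists>g. cauchy_conj f g"
  by (induction f rule: faber_induct)
    (use cauchy_conj_faber cauchy_conj_add cauchy_conj_smult in blast)+

lemma cauchy_conj_near_constant: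
  assumes "cauchy_conj f g" and f: "\<And>s. norm s = 1 \<Longrightarrow> norm (poly f (bdry s)) \<le> 1"
  obtains c where "norm c \<le> 1"
    "\<And>s. norm s = 1 \<Longrightarrow> norm (poly (g - [:c:]) (bdry s)) \<le> 4 / pi * arctan \<bar>q\<bar>"
proof -
  obtain m where "\<forall>z. norm z = 1 \<longrightarrow> circle_mean (\<lambda>w. poly f (bdry (cnj z * w))) = m \<and>
        cnj (poly g (bdry z)) = circle_mean (\<lambda>w. poly f (bdry (cnj z * w)) * of_real (poisson q w))"
    using assms(1) unfolding cauchy_conj_def by (elim conjE exE)
  hence m: "\<And>z. norm z = 1 \<Longrightarrow> circle_mean (\<lambda>w. poly f (bdry (cnj z * w))) = m"
    "\<And>z. norm z = 1 \<Longrightarrow>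
      cnj (poly g (bdry z)) = circle_mean (\<lambda>w. poly f (bdry (cnj z * w)) * of_real (poisson q w))"
    by auto
  \<comment> \<open>Because the plain mean \<open>m\<close> is the same for every \<open>z\<close>,
    subtracting \<open>k\<close> from the kernel changes \<open>g\<close> by a single constant; 0 <=
    k <= 1 keeps its modulus at most 1.\<close>
  define k where "k = (1 - q\<^sup>2) / (1 + q\<^sup>2)"
  have q2: "q\<^sup>2 < 1" using abs_q by (simp add: abs_square_less_1)
  have k: "0 \<le> k" "k \<le> 1"
    using q2 by (simp_all add: k_def divide_le_eq add_pos_nonneg)
  have fz: "norm (poly f (bdry (cnj z * w))) \<le> 1" if "norm z = 1" "norm w = 1" for z w
    using f[of "cnj z * w"] that by (simp add: norm_mult)
  have "norm m \<le> 1"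
    unfolding m(1)[of 1, symmetric, simplified]
    by (rule norm_circle_mean_le_const) (use f in \<open>auto intro!: continuous_intros\<close>)
  hence c: "norm (cnj (of_real k * m)) \<le> 1"
    using k by (simp add: norm_mult mult_le_one)
  moreover have "norm (poly (g - [:cnj (of_real k * m):]) (bdry z)) \<le> 4 / pi * arctan \<bar>q\<bar>"
    if z: "norm z = 1" for z
  proof -
    let ?G = "\<lambda>w. \<bar>poisson q w - k\<bar>"
    let ?F = "\<lambda>w. poly f (bdry (cnj z * w)) * of_real (poisson q w) - of_real k * poly f (bdry (cnj z * w))"
    have "cnj (poly (g - [:cnj (of_real k * m):]) (bdry z)) = circle_mean ?F"
      by (subst circle_mean_diff)
        (auto intro!: continuous_intros simp: m z circle_mean_mult_left)
    hence "norm (poly (g - [:cnj (of_real k * m):]) (bdry z)) = norm (circle_mean ?F)"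
      by (metis complex_mod_cnj)
    also have "\<dots> \<le> integral {- (pi / 2)..3 * pi / 2} (\<lambda>t. ?G (cis t)) / (2 * pi)"
    proof (rule norm_circle_mean_le)
      show "continuous_on (sphere 0 1) ?F"
        by (intro continuous_intros)
      show "continuous_on (sphere 0 1) ?G"
        by (intro continuous_intros continuous_on_poisson abs_q)
      fix w :: complex assume w: "norm w = 1"
      have "?F w = poly f (bdry (cnj z * w)) * of_real (poisson q w - k)"
        by (simp add: algebra_simps)
      thus "norm (?F w) \<le> ?G w"
        using fz[OF z w] by (simp add: norm_mult mult_left_le_one_le del: of_real_diff)
    qed
    also have "\<dots> = 4 / pi * arctan \<bar>q\<bar>"
      unfolding k_def by (rule poisson_L1_norm[OF abs_q])
    finally show ?thesis .
  qed
  ultimately show ?thesis using that by blast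
qed

end

section \<open>The resolvent on the exterior of the ellipse\<close>

text \<open>The Lax-Milgram argument: for small \<open>t\<close> the map sending \<open>x\<close> to
  x - t (B x - y) is a contraction, and its fixed point solves the equation.\<close>

lemma coercive_imp_surj:
  fixes B :: "'a::{real_inner, complete_space} \<Rightarrow> 'a"
  assumes B: "bounded_linear B" and d: "d > 0" and coercive: "\<And>x. inner (B x) x \<ge> d * (norm x)\<^sup>2"
  shows "\<exists>x. B x = y"
proof -
  obtain L where L: "L > 0" "\<And>x. norm (B x) \<le> norm x * L"
    using bounded_linear.pos_bounded[OF B] by blast
  define M where "M = max L d"
  have M: "M > 0" "M \<ge> d" "norm (B x) \<le> M * norm x" for x
  proof -
    have "norm x * L \<le> norm x * M"
      unfolding M_def by (intro mult_left_mono) auto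
    thus "norm (B x) \<le> M * norm x"
      using L(2)[of x] by (simp add: mult.commute)
  qed (use L d in \<open>auto simp: M_def\<close>)
  \<comment> \<open>The minimizer of 1 - 2 t d + t^2 M^2, with minimum 1 - d^2 / M^2. Taking
    \<open>M\<close> at least \<open>d\<close> makes this nonnegative.\<close>
  define t where "t = d / M\<^sup>2"
  have t: "t > 0" using M d by (simp add: t_def)
  have contraction: "norm (z - t *\<^sub>R B z) \<le> sqrt (1 - d\<^sup>2 / M\<^sup>2) * norm z" for z
  proof -
    have "(norm (z - t *\<^sub>R B z))\<^sup>2 = (norm z)\<^sup>2 - 2 * t * inner (B z) z + t\<^sup>2 * (norm (B z))\<^sup>2"
      unfolding power2_norm_eq_inner
      using inner_commute[of z "B z"]
      by (simp add: inner_diff_left inner_diff_right algebra_simps power2_eq_square)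
    also have "\<dots> \<le> (norm z)\<^sup>2 - 2 * t * (d * (norm z)\<^sup>2) + t\<^sup>2 * (M * norm z)\<^sup>2"
      using t coercive[of z] M(3)[of z]
      by (intro add_mono diff_mono mult_left_mono power_mono) auto
    also have "\<dots> = (1 - d\<^sup>2 / M\<^sup>2) * (norm z)\<^sup>2"
      using M by (simp add: t_def field_simps power2_eq_square)
    finally have "sqrt ((norm (z - t *\<^sub>R B z))\<^sup>2) \<le> sqrt ((1 - d\<^sup>2 / M\<^sup>2) * (norm z)\<^sup>2)"
      by (rule real_sqrt_le_mono)
    thus ?thesis by (simp add: real_sqrt_mult)
  qed
  have "d\<^sup>2 / M\<^sup>2 \<le> 1" "d\<^sup>2 / M\<^sup>2 > 0"
    using M d by (simp_all add: power_mono)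
  hence c: "0 \<le> sqrt (1 - d\<^sup>2 / M\<^sup>2)" "sqrt (1 - d\<^sup>2 / M\<^sup>2) < 1"
    by (auto simp: real_sqrt_lt_1_iff)
  have lin: "B (x - z) = B x - B z" for x z
    using B by (simp add: bounded_linear.linear linear_diff)
  have "\<exists>!x. x - t *\<^sub>R B x + t *\<^sub>R y = x"
  proof (rule banach_fix_type[OF c], intro allI)
    fix x z
    have "x - t *\<^sub>R B x + t *\<^sub>R y - (z - t *\<^sub>R B z + t *\<^sub>R y) = (x - z) - t *\<^sub>R B (x - z)"
      by (simp add: lin algebra_simps)
    thus "dist (x - t *\<^sub>R B x + t *\<^sub>R y) (z - t *\<^sub>R B z + t *\<^sub>R y) \<le> sqrt (1 - d\<^sup>2 / M\<^sup>2) * dist x z"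
      using contraction[of "x - z"] by (simp only: dist_norm)
  qed
  then obtain x where "x - t *\<^sub>R B x + t *\<^sub>R y = x" by blast
  hence "t *\<^sub>R B x = t *\<^sub>R y"
    by (metis add_diff_cancel_left' diff_add_eq diff_diff_eq2)
  thus ?thesis using t by auto
qed

text \<open>The assumption says that the numerical range of \<open>S\<close> lies in the ellipse shrunk by the factor
  \<open>r\<close>, in terms of supporting half planes.\<close>

locale ellipse_operator = ellipse_param al be for al be +
  fixes S :: "'a::complex_hilbert_space \<Rightarrow> 'a" and r :: real
  assumes S: "bounded_clinear S"
    and r: "0 \<le> r" "r < 1"
    and half_plane: "\<And>u x. norm u = 1 \<Longrightarrow>
      Re ((of_real al * u - of_real be * cnj u) * cinner (S x) x) \<le> r * (al\<^sup>2 - be\<^sup>2) * (norm x)\<^sup>2"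
begin

text \<open>This is \<open>s\<close> times \<psi>(1/s) - S. The factor removes the pole at s = 0, so
  the exterior of the ellipse with infinity becomes the unit disc.\<close>

definition pencil :: "complex \<Rightarrow> 'a \<Rightarrow> 'a"
  where "pencil s x = (of_real al + of_real be * s\<^sup>2) *\<^sub>C x - s *\<^sub>C S x"

definition coerc :: real where "coerc = (al - \<bar>be\<bar>)\<^sup>2 * (1 - r)"

lemma coerc_pos: "coerc > 0"
  using al_be r by (simp add: coerc_def)

text \<open>The estimate behind \<open>coercive_pencil\<close> for \<open>s\<close> of modulus
  \<open>p\<close>, with \<open>c\<close> standing for Re (u^2). Once \<open>be * c\<close> is
  replaced by its bound \<open>\<bar>be\<bar>\<close>, the slack factors into terms that are
  nonnegative for \<open>p\<close> and \<open>r\<close> in [0, 1].\<close>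

lemma coercive_scalar:
  fixes p c :: real
  assumes p: "0 \<le> p" "p \<le> 1" and c: "\<bar>c\<bar> \<le> 1"
  shows "coerc \<le> al\<^sup>2 - be\<^sup>2 * p\<^sup>2 - al * be * (1 - p\<^sup>2) * c - p * (r * (al\<^sup>2 - be\<^sup>2))"
proof -
  define B where "B = \<bar>be\<bar>"
  have B: "B \<ge> 0" "al - B > 0" "be\<^sup>2 = B\<^sup>2" using al_be by (auto simp: B_def)
  have p2: "p\<^sup>2 \<le> 1" using p by (simp add: power_le_one)
  have "be * c \<le> B"
    using c mult_left_le[of "\<bar>c\<bar>" "\<bar>be\<bar>"] abs_ge_self[of "be * c"] by (simp add: B_def abs_mult)
  hence "al * (1 - p\<^sup>2) * (be * c) \<le> al * (1 - p\<^sup>2) * B"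
    using al_pos p2 by (intro mult_left_mono) auto
  moreover have "al\<^sup>2 - B\<^sup>2 * p\<^sup>2 - al * (1 - p\<^sup>2) * B - p * (r * (al\<^sup>2 - B\<^sup>2)) - (al - B)\<^sup>2 * (1 - r)
     = (al - B) * ((al - B) * r * (1 - p) + B * ((1 - p)\<^sup>2 + 2 * p * (1 - r)))"
    by algebra
  moreover have "\<dots> \<ge> 0"
    using B p r by (intro mult_nonneg_nonneg add_nonneg_nonneg) auto
  moreover have "al * be * (1 - p\<^sup>2) * c = al * (1 - p\<^sup>2) * (be * c)"
    by simp
  ultimately show ?thesis
    unfolding coerc_def B(3) B_def[symmetric] by linarith
qed

text \<open>The multiplier turns the factor \<open>u\<close> of \<open>S\<close> into al u - be (cnj
  u), the conjugate of the outward normal at \<open>bdry u\<close>, so \<open>half_plane\<close>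
  applies. The same multiplier serves the whole radius through \<open>u\<close>.\<close>

lemma coercive_pencil:
  assumes u: "norm u = 1" and p: "0 \<le> p" "p \<le> 1"
  shows "coerc * (norm x)\<^sup>2 \<le>
    Re ((of_real al - of_real be * (cnj u)\<^sup>2) * cinner (pencil (of_real p * u) x) x)"
proof -
  have Re_of_real_mult: "Re (complex_of_real c * z) = c * Re z" for c z
    by simp
  define s where "s = of_real p * u"
  define W where "W = cinner (S x) x"
  have uu: "u * cnj u = 1"
    by (rule cnj_eq_inverse_unit[OF u])
  have A: "cinner (pencil s x) x = (of_real al + of_real be * s\<^sup>2) * of_real ((norm x)\<^sup>2) - s * W"
    by (simp add: pencil_def cinner_diff_left cinner_scaleC_left cinner_self W_def)
  have "(of_real al - of_real be * (cnj u)\<^sup>2) * cinner (pencil s x) x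
     = of_real ((norm x)\<^sup>2) * (of_real (al\<^sup>2) - of_real (be\<^sup>2 * p\<^sup>2) * (u * cnj u)\<^sup>2
         + of_real (al * be) * (of_real (p\<^sup>2) * u\<^sup>2 - (cnj u)\<^sup>2))
       - of_real p * ((of_real al * u - of_real be * cnj u * (u * cnj u)) * W)"
    unfolding A unfolding s_def by (simp add: algebra_simps power2_eq_square)
  also have "Re \<dots> = (norm x)\<^sup>2 * (al\<^sup>2 - be\<^sup>2 * p\<^sup>2 + al * be * (p\<^sup>2 * Re (u\<^sup>2) - Re ((cnj u)\<^sup>2)))
      - p * Re ((of_real al * u - of_real be * cnj u) * W)"
    unfolding uu by (simp only: Re_of_real_mult Re_complex_of_real minus_complex.sel plus_complex.sel
        power_one mult_1_right)
  also have "Re ((cnj u)\<^sup>2) = Re (u\<^sup>2)"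
    by (simp flip: complex_cnj_power)
  finally have eq: "Re ((of_real al - of_real be * (cnj u)\<^sup>2) * cinner (pencil s x) x)
     = (norm x)\<^sup>2 * (al\<^sup>2 - be\<^sup>2 * p\<^sup>2 + al * be * (p\<^sup>2 * Re (u\<^sup>2) - Re (u\<^sup>2)))
      - p * Re ((of_real al * u - of_real be * cnj u) * W)" .
  have "p * Re ((of_real al * u - of_real be * cnj u) * W) \<le> p * (r * (al\<^sup>2 - be\<^sup>2) * (norm x)\<^sup>2)"
    using half_plane[OF u, of x] p by (intro mult_left_mono) (auto simp: W_def)
  moreover have "\<bar>Re (u\<^sup>2)\<bar> \<le> 1"
    using abs_Re_le_cmod[of "u\<^sup>2"] u by (simp add: norm_power)
  note mult_left_mono[OF coercive_scalar[OF p this], of "(norm x)\<^sup>2"]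
  ultimately show ?thesis
    unfolding s_def[symmetric] eq by (simp add: algebra_simps)
qed

lemma unit_polar:
  fixes z :: complex
  obtains u where "norm u = 1" "z = of_real (norm z) * u"
proof (cases "z = 0")
  case True
  thus ?thesis using that[of 1] by simp
next
  case False
  hence "norm (sgn z) = 1" "z = of_real (norm z) * sgn z"
    by (simp_all add: sgn_eq norm_divide)
  thus ?thesis by (rule that)
qed

lemma norm_factor:
  fixes u :: complex
  assumes "norm u = 1"
  shows "norm (of_real al - of_real be * u\<^sup>2) \<le> 2 * al" "of_real al - of_real be * u\<^sup>2 \<noteq> 0"
proof -
  have n: "norm (of_real be * u\<^sup>2) = \<bar>be\<bar>"
    using assms by (simp add: norm_mult norm_power)
  show "norm (of_real al - of_real be * u\<^sup>2) \<le> 2 * al"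
    using norm_triangle_ineq4[of "of_real al" "of_real be * u\<^sup>2"] n al_be al_pos by simp
  show "of_real al - of_real be * u\<^sup>2 \<noteq> 0"
    using n al_be al_pos by (metis eq_iff_diff_eq_0 norm_of_real abs_of_pos order_less_irrefl)
qed

lemma pencil_linear:
  "pencil s (x + y) = pencil s x + pencil s y"
  "pencil s (x - y) = pencil s x - pencil s y"
  "pencil s (c *\<^sub>C x) = c *\<^sub>C pencil s x"
  by (simp_all add: pencil_def scaleC_add_right scaleC_diff_right clinear_add[OF S]
      clinear_diff[OF S] clinear_scaleC[OF S] scaleC_scaleC mult.commute)

lemma norm_le_pencil:
  assumes "norm s \<le> 1"
  shows "norm x \<le> 2 * al / coerc * norm (pencil s x)"
proof (cases "x = 0")
  case False
  obtain u where u: "norm u = 1" "s = of_real (norm s) * u"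
    by (rule unit_polar)
  have "coerc * (norm x)\<^sup>2 \<le> Re ((of_real al - of_real be * (cnj u)\<^sup>2) * cinner (pencil s x) x)"
    using coercive_pencil[OF u(1) norm_ge_zero assms, of x] u(2) by simp
  also have "\<dots> \<le> norm (of_real al - of_real be * (cnj u)\<^sup>2) * norm (cinner (pencil s x) x)"
    unfolding norm_mult[symmetric] by (rule complex_Re_le_cmod)
  also have "\<dots> \<le> 2 * al * (norm (pencil s x) * norm x)"
    using norm_factor(1)[of "cnj u"] u(1) al_pos
    by (intro mult_mono norm_cinner_le) auto
  finally have "(coerc * norm x) * norm x \<le> (2 * al * norm (pencil s x)) * norm x"
    by (simp add: power2_eq_square mult_ac)
  hence "coerc * norm x \<le> 2 * al * norm (pencil s x)"
    using False by simp
  thus ?thesis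
    using coerc_pos by (simp add: field_simps)
qed (use coerc_pos al_pos in simp)

text \<open>The pencil is coercive only after multiplication by a scalar depending on the direction
  of \<open>s\<close>; that scalar is nonzero and is cancelled at the end.\<close>

lemma surj_pencil:
  assumes "norm s \<le> 1"
  shows "\<exists>x. pencil s x = y"
proof -
  obtain u where u: "norm u = 1" "s = of_real (norm s) * u"
    by (rule unit_polar)
  define v where "v = of_real al - of_real be * (cnj u)\<^sup>2"
  obtain C where C: "\<And>x. norm (S x) \<le> norm x * C"
    using S bounded_linear.bounded unfolding bounded_clinear_def by blast
  have "bounded_linear (\<lambda>x. v *\<^sub>C pencil s x)"
  proof (rule bounded_linear_intro)
    show "v *\<^sub>C pencil s (x + y) = v *\<^sub>C pencil s x + v *\<^sub>C pencil s y" for x y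
      by (simp add: pencil_linear scaleC_add_right)
    show "v *\<^sub>C pencil s (k *\<^sub>R x) = k *\<^sub>R (v *\<^sub>C pencil s x)" for k x
      by (metis pencil_linear(3) scaleC_of_real scaleC_scaleR)
    show "norm (v *\<^sub>C pencil s x) \<le> norm x * (norm v * (norm (of_real al + of_real be * s\<^sup>2) + norm s * C))" for x
    proof -
      have "norm (pencil s x) \<le> norm (of_real al + of_real be * s\<^sup>2) * norm x + norm s * norm (S x)"
        unfolding pencil_def by (metis norm_scaleC norm_triangle_ineq4)
      also have "\<dots> \<le> norm (of_real al + of_real be * s\<^sup>2) * norm x + norm s * (norm x * C)"
        by (intro add_left_mono mult_left_mono C) auto
      finally have "norm v * norm (pencil s x) \<le> norm v * \<dots>"
        by (rule mult_left_mono) auto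
      thus ?thesis by (simp add: norm_scaleC algebra_simps)
    qed
  qed
  moreover have "inner (v *\<^sub>C pencil s x) x \<ge> coerc * (norm x)\<^sup>2" for x
    using coercive_pencil[OF u(1) norm_ge_zero assms, of x] u(2)
    by (simp add: inner_eq_Re_cinner cinner_scaleC_left v_def)
  ultimately obtain x where "v *\<^sub>C pencil s x = v *\<^sub>C y"
    using coercive_imp_surj[OF _ coerc_pos] by blast
  hence "(inverse v * v) *\<^sub>C pencil s x = (inverse v * v) *\<^sub>C y"
    by (simp flip: scaleC_scaleC)
  thus ?thesis
    using norm_factor(2)[of "cnj u"] u(1) by (auto simp: v_def)
qed

definition resolv :: "complex \<Rightarrow> 'a \<Rightarrow> 'a"
  where "resolv s y = (SOME x. pencil s x = y)"

context
  fixes s :: complex assumes s: "norm s \<le> 1"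
begin

lemma pencil_resolv: "pencil s (resolv s y) = y"
  unfolding resolv_def by (rule someI_ex[OF surj_pencil[OF s]])

lemma resolv_pencil: "resolv s (pencil s x) = x"
proof -
  have "pencil s (resolv s (pencil s x) - x) = 0"
    by (simp add: pencil_linear pencil_resolv)
  thus ?thesis
    using norm_le_pencil[OF s, of "resolv s (pencil s x) - x"] by simp
qed

lemma norm_resolv: "norm (resolv s y) \<le> 2 * al / coerc * norm y"
  using norm_le_pencil[OF s, of "resolv s y"] by (simp add: pencil_resolv)

lemma resolv_diff: "resolv s (x - y) = resolv s x - resolv s y"
  and resolv_scaleC: "resolv s (c *\<^sub>C x) = c *\<^sub>C resolv s x"
  using resolv_pencil[of "resolv s x - resolv s y"]
    resolv_pencil[of "c *\<^sub>C resolv s x"]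
  by (simp_all add: pencil_linear pencil_resolv)

lemma resolv_S: "resolv s (S x) = S (resolv s x)"
proof -
  have "pencil s (S (resolv s x)) = S (pencil s (resolv s x))"
    by (simp add: pencil_def clinear_diff[OF S] clinear_scaleC[OF S])
  thus ?thesis by (metis pencil_resolv resolv_pencil)
qed

end

text \<open>The pencil is quadratic in its parameter, hence the extra term with \<open>s + t\<close>
  compared with the classical identity.\<close>

lemma resolvent_identity:
  assumes "norm s \<le> 1" "norm t \<le> 1"
  shows "resolv t x - resolv s x =
    (t - s) *\<^sub>C (resolv t (S (resolv s x) - (of_real be * (s + t)) *\<^sub>C resolv s x))"
proof -
  define v where "v = resolv s x"
  have "resolv t x - v = resolv t (pencil s v - pencil t v)"
    using assms by (simp add: resolv_diff resolv_pencil pencil_resolv v_def)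
  also have "pencil s v - pencil t v
     = ((of_real al + of_real be * s\<^sup>2) - (of_real al + of_real be * t\<^sup>2)) *\<^sub>C v + (t - s) *\<^sub>C S v"
    unfolding pencil_def scaleC_diff_left by simp
  also have "(of_real al + of_real be * s\<^sup>2) - (of_real al + of_real be * t\<^sup>2)
     = - ((t - s) * (of_real be * (s + t)))"
    by algebra
  also have "(- ((t - s) * (of_real be * (s + t)))) *\<^sub>C v + (t - s) *\<^sub>C S v
     = (t - s) *\<^sub>C (S v - (of_real be * (s + t)) *\<^sub>C v)"
    by (simp add: scaleC_diff_right scaleC_scaleC)
  finally show ?thesis
    using assms(2) by (simp add: resolv_scaleC v_def)
qed

lemma continuous_on_resolv: "continuous_on (cball 0 1) (\<lambda>s. cinner (resolv s x) y)"
  unfolding continuous_on_def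
proof
  fix s :: complex assume "s \<in> cball 0 1"
  hence s: "norm s \<le> 1" by simp
  define v where "v = resolv s x"
  define C where "C = 2 * al / coerc * (norm (S v) + 2 * \<bar>be\<bar> * norm v) * norm y"
  have C: "norm (cinner (resolv t x) y - cinner (resolv s x) y) \<le> norm (t - s) * C"
    if t: "norm t \<le> 1" for t
  proof -
    let ?z = "S v - (of_real be * (s + t)) *\<^sub>C v"
    have "norm (s + t) \<le> 2"
      using s t norm_triangle_ineq[of s t] by linarith
    hence "\<bar>be\<bar> * norm (s + t) * norm v \<le> \<bar>be\<bar> * 2 * norm v"
      by (intro mult_right_mono mult_left_mono) auto
    hence z: "norm ?z \<le> norm (S v) + 2 * \<bar>be\<bar> * norm v"
      using norm_triangle_ineq4[of "S v" "(of_real be * (s + t)) *\<^sub>C v"]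
      by (simp add: norm_scaleC norm_mult)
    have "norm (cinner (resolv t x) y - cinner (resolv s x) y) = norm (t - s) * norm (cinner (resolv t ?z) y)"
      by (simp add: cinner_diff_left[symmetric] resolvent_identity[OF s t] cinner_scaleC_left
          norm_mult v_def)
    also have "norm (cinner (resolv t ?z) y) \<le> norm (resolv t ?z) * norm y"
      by (rule norm_cinner_le)
    also have "\<dots> \<le> C"
      unfolding C_def using al_pos coerc_pos
      by (intro mult_right_mono order.trans[OF norm_resolv[OF t]] mult_left_mono z) auto
    finally show ?thesis by (simp add: mult_left_mono)
  qed
  have "((\<lambda>t. norm (t - s) * C) \<longlongrightarrow> norm (s - s) * C) (at s within cball 0 1)"
    by (intro tendsto_intros)
  hence lim: "((\<lambda>t. norm (t - s) * C) \<longlongrightarrow> 0) (at s within cball 0 1)" by simp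
  show "((\<lambda>s. cinner (resolv s x) y) \<longlongrightarrow> cinner (resolv s x) y) (at s within cball 0 1)"
    by (rule Lim_null[THEN iffD2], rule Lim_null_comparison[OF _ lim])
      (use C in \<open>auto simp: eventually_at_filter\<close>)
qed

lemma holomorphic_resolv: "(\<lambda>s. cinner (resolv s x) y) holomorphic_on cball 0 1"
  unfolding holomorphic_on_def field_differentiable_def has_field_derivative_iff
proof
  fix s :: complex assume sb: "s \<in> cball 0 1"
  hence s: "norm s \<le> 1" by simp
  define v where "v = resolv s x"
  define z where "z = S v - (of_real be * (2 * s)) *\<^sub>C v"
  \<comment> \<open>The difference quotient with the division carried out. Splitting off be (t - s)
    v leaves \<open>resolv t\<close> acting on the fixed vectors \<open>z\<close> and
    \<open>v\<close>, so \<open>continuous_on_resolv\<close> suffices.\<close>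
  define F where "F = (\<lambda>t. cinner (resolv t z) y - of_real be * (t - s) * cinner (resolv t v) y)"
  have "continuous_on (cball 0 1) F"
    unfolding F_def by (intro continuous_intros continuous_on_resolv)
  hence "(F \<longlongrightarrow> F s) (at s within cball 0 1)"
    using sb by (simp add: continuous_on_def)
  moreover have "eventually (\<lambda>t. F t = (cinner (resolv t x) y - cinner (resolv s x) y) / (t - s))
      (at s within cball 0 1)"
    unfolding eventually_at_filter
  proof (intro always_eventually allI impI)
    fix t assume "t \<noteq> s" "t \<in> cball 0 1"
    hence t: "norm t \<le> 1" by simp
    have "S v - (of_real be * (s + t)) *\<^sub>C v = z - (of_real be * (t - s)) *\<^sub>C v"
      unfolding z_def diff_diff_eq scaleC_add_left[symmetric] by (simp add: algebra_simps)
    hence "cinner (resolv t x) y - cinner (resolv s x) y = (t - s) * F t"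
      using resolvent_identity[OF s t, of x]
      by (simp add: cinner_diff_left[symmetric] cinner_scaleC_left F_def v_def[symmetric]
          resolv_diff[OF t] resolv_scaleC[OF t])
        (simp add: cinner_diff_left cinner_scaleC_left)
    thus "F t = (cinner (resolv t x) y - cinner (resolv s x) y) / (t - s)"
      using \<open>t \<noteq> s\<close> by simp
  qed
  ultimately have "((\<lambda>t. (cinner (resolv t x) y - cinner (resolv s x) y) / (t - s)) \<longlongrightarrow> F s)
      (at s within cball 0 1)"
    by (rule Lim_transform_eventually)
  thus "\<exists>D. ((\<lambda>t. (cinner (resolv t x) y - cinner (resolv s x) y) / (t - s)) \<longlongrightarrow> D)
      (at s within cball 0 1)" ..
qed

end

section \<open>The operator inequalities\<close>

context ellipse_operator
begin

text \<open>In terms of the exterior map \<open>\<psi>\<close> and \<open>w = cnj s\<close>, this is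
  \<open>\<langle>w \<psi>'(w) (\<psi>(w) - S)\<^sup>-\<^sup>1 x, y\<rangle>\<close>, the generating function of the Faber polynomials of \<open>S\<close>.\<close>

definition kern :: "'a \<Rightarrow> 'a \<Rightarrow> complex \<Rightarrow> complex"
  where "kern x y s = (of_real al - of_real be * s\<^sup>2) * cinner (resolv s x) y"

lemma holomorphic_kern: "kern x y holomorphic_on cball 0 1"
  unfolding kern_def by (intro holomorphic_intros holomorphic_resolv)

lemma continuous_on_kern [continuous_intros]: "continuous_on (sphere 0 1) (\<lambda>s. kern x y s)"
  by (rule continuous_on_subset[OF holomorphic_on_imp_continuous_on[OF holomorphic_kern]]) auto

lemma kern_eq:
  assumes "norm s \<le> 1"
  shows "(of_real al + of_real be * s\<^sup>2) * kern x y s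
    = s * kern (S x) y s + (of_real al - of_real be * s\<^sup>2) * cinner x y"
proof -
  have "cinner (pencil s (resolv s x)) y = cinner x y"
    using assms by (simp add: pencil_resolv)
  hence *: "(of_real al + of_real be * s\<^sup>2) * cinner (resolv s x) y = s * cinner (resolv s (S x)) y + cinner x y"
    using assms by (simp add: pencil_def cinner_diff_left cinner_scaleC_left resolv_S algebra_simps)
  show ?thesis
    unfolding kern_def mult.left_commute[of _ "of_real al - of_real be * s\<^sup>2"] * by (rule distrib_left)
qed

text \<open>The identity z (z - S)^(-1) = S (z - S)^(-1) + 1 at z = \<open>bdry s\<close>, times the
  normal vector.\<close>

lemma bdry_kern:
  assumes "norm s = 1"
  shows "bdry s * kern x y s = kern (S x) y s + (of_real al * cnj s - of_real be * s) * cinner x y"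
proof -
  have ss: "cnj s * s = 1"
    using cnj_eq_inverse_unit[OF assms] by (simp add: mult.commute)
  have "bdry s * kern x y s = cnj s * ((of_real al + of_real be * s\<^sup>2) * kern x y s)
      + of_real be * s * kern x y s * (1 - cnj s * s)"
    by (simp add: bdry_def power2_eq_square algebra_simps)
  also have "\<dots> = cnj s * (s * kern (S x) y s + (of_real al - of_real be * s\<^sup>2) * cinner x y)"
    using assms by (simp only: ss kern_eq) simp
  also have "\<dots> = (cnj s * s) * kern (S x) y s + (of_real al * cnj s - of_real be * s * (cnj s * s)) * cinner x y"
    by (simp add: power2_eq_square algebra_simps)
  finally show ?thesis by (simp add: ss)
qed

text \<open>The mean value property, the value at s = 0 being \<open>cinner x y\<close>. To use
  \<open>circle_mean_Cauchy\<close>, the remainder is put in the form s k(s) by means of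
  \<open>kern_eq\<close>.\<close>

lemma circle_mean_kern: "circle_mean (kern x y) = cinner x y"
proof -
  define K where "K s = kern (S x) y s - of_real be * s * kern x y s - of_real be * s * cinner x y" for s
  define k where "k s = inverse (of_real al) * K s" for s
  have "kern x y s = cinner x y + s * k s" if "norm s = 1" for s
  proof -
    have "of_real al * kern x y s = of_real al * cinner x y + s * K s"
      using kern_eq[of s x y] that by (simp add: K_def power2_eq_square algebra_simps)
    also have "\<dots> = of_real al * (cinner x y + s * k s)"
      using al_pos by (simp add: k_def distrib_left)
    finally show ?thesis using al_pos by simp
  qed
  hence "circle_mean (kern x y) = circle_mean (\<lambda>s. cinner x y + s * k s)"
    by (rule circle_mean_cong)
  also have "\<dots> = circle_mean (\<lambda>s. cinner x y) + circle_mean (\<lambda>s. s * k s)"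
    unfolding k_def K_def by (intro circle_mean_add continuous_intros)
  also have "circle_mean (\<lambda>s. s * k s) = 0"
    unfolding k_def K_def by (intro circle_mean_Cauchy holomorphic_intros holomorphic_kern)
  finally show ?thesis by (simp add: circle_mean_const)
qed

text \<open>Cauchy's integral formula for f(S). In the induction \<open>bdry_kern\<close> trades a
  factor z for \<open>S\<close> on the vector, and the leftover scalar term integrates a polynomial
  over a closed curve.\<close>

lemma circle_mean_poly_kern:
  "circle_mean (\<lambda>s. poly f (bdry s) * kern x y s) = cinner (op_poly f S x) y"
proof (induction f arbitrary: x)
  case 0
  show ?case by (simp add: circle_mean_const)
next
  case (pCons c f)
  have "circle_mean (\<lambda>s. poly (pCons c f) (bdry s) * kern x y s)
      = circle_mean (\<lambda>s. c * kern x y s + poly f (bdry s) * kern (S x) y s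
          + cinner x y * (poly f (bdry s) * (of_real al * cnj s - of_real be * s)))"
  proof (rule circle_mean_cong)
    fix s :: complex assume s: "norm s = 1"
    have "poly (pCons c f) (bdry s) * kern x y s = c * kern x y s + poly f (bdry s) * (bdry s * kern x y s)"
      by (simp add: algebra_simps)
    thus "poly (pCons c f) (bdry s) * kern x y s = c * kern x y s + poly f (bdry s) * kern (S x) y s
          + cinner x y * (poly f (bdry s) * (of_real al * cnj s - of_real be * s))"
      unfolding bdry_kern[OF s] by (simp add: algebra_simps)
  qed
  also have "\<dots> = c * circle_mean (kern x y) + circle_mean (\<lambda>s. poly f (bdry s) * kern (S x) y s)
      + cinner x y * circle_mean (\<lambda>s. poly f (bdry s) * (of_real al * cnj s - of_real be * s))"
    unfolding circle_mean_mult_left[symmetric]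
    by (subst circle_mean_add; (intro continuous_intros)?)+ simp
  finally show ?case
    by (simp add: pCons.IH circle_mean_kern circle_mean_bdry_derivative op_poly_pCons
        cinner_add_left cinner_scaleC_left)
qed

text \<open>For \<open>x = pencil s v\<close> the kernel is the conjugate of the form in
  \<open>coercive_pencil\<close> on the unit circle.\<close>

lemma kern_nonneg:
  assumes s: "norm s = 1"
  shows "Re (kern x x s) \<ge> 0"
proof -
  define v where "v = resolv s x"
  have "kern x x s = (of_real al - of_real be * s\<^sup>2) * cinner v (pencil s v)"
    using s by (simp add: kern_def v_def pencil_resolv)
  also have "\<dots> = cnj ((of_real al - of_real be * (cnj s)\<^sup>2) * cinner (pencil s v) v)"
    using cinner_commute[of v "pencil s v"] by simp
  finally have "Re (kern x x s) = Re ((of_real al - of_real be * (cnj s)\<^sup>2) * cinner (pencil s v) v)"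
    by (simp only: cnj.sel)
  moreover have "0 \<le> coerc * (norm v)\<^sup>2"
    using coerc_pos by simp
  ultimately show ?thesis
    using coercive_pencil[OF s, of 1 v] by simp
qed

text \<open>The left side is the modulus of a positive Hermitian form at (x, y); evaluate the form
  at c x - y with a suitable phase \<open>c\<close>. The bound by a sum, unlike one by a geometric
  mean, can be integrated directly.\<close>

lemma norm_kern_add_cnj_le:
  assumes s: "norm s = 1"
  shows "norm (kern x y s + cnj (kern y x s)) \<le> Re (kern x x s + kern y y s)"
proof -
  define b where "b = kern x y s + cnj (kern y x s)"
  obtain c where c: "norm c = 1" "c * b = of_real (norm b)"
    using exists_phase by blast
  have cc: "c * cnj c = 1"
    by (rule cnj_eq_inverse_unit[OF c(1)])
  have "kern (c *\<^sub>C x - y) (c *\<^sub>C x - y) s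
      = (c * cnj c) * kern x x s + kern y y s - (c * kern x y s + cnj c * kern y x s)"
    using s by (simp add: kern_def resolv_diff resolv_scaleC cinner_diff_left cinner_diff_right
        cinner_scaleC_left cinner_scaleC_right algebra_simps)
  moreover have "Re (c * kern x y s + cnj c * kern y x s) = Re (c * b)"
    by (simp add: b_def distrib_left)
  ultimately have "Re (kern (c *\<^sub>C x - y) (c *\<^sub>C x - y) s) = Re (kern x x s) + Re (kern y y s) - norm b"
    by (simp only: cc c(2) mult_1 minus_complex.sel plus_complex.sel Re_complex_of_real)
  thus ?thesis
    using kern_nonneg[OF s, of "c *\<^sub>C x - y"] by (simp add: b_def)
qed

text \<open>On the circle the conjugate of \<open>f\<close> is g - s p, and \<open>s * p\<close>
  times the holomorphic kernel has mean zero.\<close>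

lemma cauchy_conj_operator:
  assumes "cauchy_conj f g"
  shows "circle_mean (\<lambda>s. poly f (bdry s) * cnj (kern y x s)) = cinner x (op_poly g S y)"
proof -
  obtain p where p: "\<forall>s. norm s = 1 \<longrightarrow> poly g (bdry s) = cnj (poly f (bdry s)) + s * poly p s"
    using assms unfolding cauchy_conj_def by blast
  have "circle_mean (\<lambda>s. poly f (bdry s) * cnj (kern y x s))
      = cnj (circle_mean (\<lambda>s. cnj (poly f (bdry s)) * kern y x s))"
    by (simp flip: circle_mean_cnj)
  also have "circle_mean (\<lambda>s. cnj (poly f (bdry s)) * kern y x s)
      = circle_mean (\<lambda>s. poly g (bdry s) * kern y x s - s * (poly p s * kern y x s))"
    using p by (intro circle_mean_cong) (simp add: algebra_simps)
  also have "\<dots> = circle_mean (\<lambda>s. poly g (bdry s) * kern y x s) - circle_mean (\<lambda>s. s * (poly p s * kern y x s))"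
    by (intro circle_mean_diff continuous_intros)
  also have "circle_mean (\<lambda>s. s * (poly p s * kern y x s)) = 0"
    by (intro circle_mean_Cauchy holomorphic_intros holomorphic_kern)
  finally show ?thesis
    by (simp add: circle_mean_poly_kern flip: cinner_commute)
qed

definition contractive :: "complex poly \<Rightarrow> bool"
  where "contractive f \<longleftrightarrow> (\<forall>s. norm s = 1 \<longrightarrow> norm (poly f (bdry s)) \<le> 1)"

text \<open>The sum is the mean of \<open>f\<close> against the Hermitian form above; the mean of
  its majorant is the sum of the squared norms of \<open>x\<close> and \<open>y\<close>.\<close>

lemma cauchy_conj_operator_bound:
  assumes "cauchy_conj f g" "contractive f" "norm x = 1" "norm y = 1"
  shows "norm (cinner (op_poly f S x) y + cinner x (op_poly g S y)) \<le> 2"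
proof -
  let ?F = "\<lambda>s. poly f (bdry s) * (kern x y s + cnj (kern y x s))"
  let ?G = "\<lambda>s. Re (kern x x s + kern y y s)"
  have G: "continuous_on (sphere 0 1) ?G"
    by (intro continuous_intros)
  have "cinner (op_poly f S x) y + cinner x (op_poly g S y) = circle_mean ?F"
    unfolding cauchy_conj_operator[OF assms(1), symmetric] circle_mean_poly_kern[symmetric] distrib_left
    by (intro circle_mean_add[symmetric] continuous_intros)
  also have "norm \<dots> \<le> integral {- (pi / 2)..3 * pi / 2} (\<lambda>t. ?G (cis t)) / (2 * pi)"
  proof (rule norm_circle_mean_le[OF _ G])
    show "continuous_on (sphere 0 1) ?F"
      by (intro continuous_intros)
    fix s :: complex assume s: "norm s = 1"
    have "norm (?F s) \<le> 1 * ?G s"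
      unfolding norm_mult using assms(2) s
      by (intro mult_mono norm_kern_add_cnj_le) (auto simp: contractive_def)
    thus "norm (?F s) \<le> ?G s" by simp
  qed
  also have "\<dots> = Re (circle_mean (\<lambda>s. complex_of_real (?G s)))"
    unfolding circle_mean_of_real[OF G] by (simp only: Re_complex_of_real)
  also have "(\<lambda>s. complex_of_real (?G s)) = (\<lambda>s. 1 / 2 * ((kern x x s + kern y y s) + cnj (kern x x s + kern y y s)))"
    by (rule ext) (simp add: complex_eq_iff)
  also have "circle_mean \<dots> = of_real (Re (circle_mean (\<lambda>s. kern x x s + kern y y s)))"
    by (subst circle_mean_mult_left, subst circle_mean_add, (intro continuous_intros)+,
        subst circle_mean_cnj, subst complex_add_cnj) simp
  also have "circle_mean (\<lambda>s. kern x x s + kern y y s) = 2"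
    by (subst circle_mean_add) (auto intro!: continuous_intros simp: circle_mean_kern cinner_self assms)
  finally show ?thesis by simp
qed

text \<open>A crude bound, blowing up as \<open>r\<close> tends to 1, which serves to make the best
  constant finite.\<close>

lemma op_poly_bounded:
  obtains M where "M > 0" "\<And>f x. contractive f \<Longrightarrow> norm (op_poly f S x) \<le> M * norm x"
proof
  define M where "M = 2 * al * (2 * al / coerc)"
  show "M > 0" using al_pos coerc_pos by (simp add: M_def)
  fix f x assume f: "contractive f"
  define y where "y = op_poly f S x"
  have yy: "cinner y y = circle_mean (\<lambda>s. poly f (bdry s) * kern x y s)"
    by (simp add: circle_mean_poly_kern y_def)
  have "norm (cinner y y) \<le> M * norm x * norm y"
    unfolding yy
  proof (rule norm_circle_mean_le_const)
    show "continuous_on (sphere 0 1) (\<lambda>s. poly f (bdry s) * kern x y s)"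
      by (intro continuous_intros)
    fix s :: complex assume s: "norm s = 1"
    have "norm (poly f (bdry s) * kern x y s)
        \<le> 1 * (2 * al * ((2 * al / coerc * norm x) * norm y))"
      unfolding norm_mult kern_def using f s al_pos coerc_pos
      by (intro mult_mono norm_factor order.trans[OF norm_cinner_le] norm_resolv)
        (auto simp: contractive_def)
    thus "norm (poly f (bdry s) * kern x y s) \<le> M * norm x * norm y"
      by (simp add: M_def mult_ac)
  qed
  hence "norm y * norm y \<le> (M * norm x) * norm y"
    by (simp only: cinner_self norm_of_real abs_power2 power2_eq_square)
  thus "norm (op_poly f S x) \<le> M * norm x"
    unfolding y_def[symmetric] using \<open>M > 0\<close> by (cases "y = 0") auto
qed

end

section \<open>Nearly extremal polynomials\<close>

lemma le_of_le_add_small_mult: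
  fixes a b c :: real
  assumes "\<And>e. 0 < e \<Longrightarrow> e \<le> 1 \<Longrightarrow> a \<le> b + e * c"
  shows "a \<le> b"
proof (rule ccontr)
  assume "\<not> a \<le> b"
  hence ab: "a - b > 0" by simp
  define d where "d = \<bar>c\<bar> + 1"
  have d: "c \<le> d" "d > 0"
    by (auto simp: d_def)
  define e where "e = min 1 ((a - b) / (2 * d))"
  have e: "0 < e" "e \<le> 1" "e \<le> (a - b) / (2 * d)"
    using ab d by (auto simp: e_def)
  have "e * c \<le> e * d"
    using e(1) d by (intro mult_left_mono) auto
  also have "\<dots> \<le> (a - b) / (2 * d) * d"
    using e(3) d by (intro mult_right_mono) auto
  also have "\<dots> = (a - b) / 2"
    using d by simp
  finally show False
    using assms[OF e(1,2)] ab by simp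
qed

text \<open>First-order perturbation of a self-map of the disc by a Moebius transformation.\<close>

lemma norm_moebius_perturbation_le:
  fixes z l :: complex
  assumes z: "norm z \<le> 1" and l: "norm l \<le> 1"
  shows "norm (z - l + cnj l * (z * z)) \<le> 1 + 2 * (norm l)\<^sup>2"
proof -
  \<comment> \<open>The Moebius map (z - l) / (1 - cnj l z) preserves the disc. Multiplying by 1 +
    cnj l z in place of the division is exact to first order in \<open>l\<close> and keeps the
    expression polynomial in \<open>z\<close>.\<close>
  have "norm (z - l) \<le> norm (1 - cnj l * z)"
  proof -
    have "(1 - (norm z)\<^sup>2) * (1 - (norm l)\<^sup>2) \<ge> 0"
      using z l by (intro mult_nonneg_nonneg) (auto simp: power_le_one)
    moreover have "(norm (1 - cnj l * z))\<^sup>2 - (norm (z - l))\<^sup>2 = (1 - (norm z)\<^sup>2) * (1 - (norm l)\<^sup>2)"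
      unfolding cmod_power2 by (simp add: power2_eq_square algebra_simps)
    ultimately have "(norm (z - l))\<^sup>2 \<le> (norm (1 - cnj l * z))\<^sup>2"
      by linarith
    thus ?thesis
      by (rule power2_le_imp_le) simp
  qed
  hence "norm (z - l) * norm (1 + cnj l * z) \<le> norm (1 - cnj l * z) * norm (1 + cnj l * z)"
    by (rule mult_right_mono) auto
  also have "\<dots> = norm (1 - (cnj l)\<^sup>2 * z\<^sup>2)"
    unfolding norm_mult[symmetric] by (simp add: power2_eq_square algebra_simps)
  also have "\<dots> \<le> 1 + (norm l)\<^sup>2 * (norm z)\<^sup>2"
    using norm_triangle_ineq4[of 1 "(cnj l)\<^sup>2 * z\<^sup>2"] by (simp add: norm_mult norm_power)
  also have "\<dots> \<le> 1 + (norm l)\<^sup>2 * 1"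
    using z by (intro add_left_mono mult_left_mono) (auto simp: power_le_one)
  finally have 1: "norm ((z - l) * (1 + cnj l * z)) \<le> 1 + (norm l)\<^sup>2"
    by (simp add: norm_mult)
  have 2: "norm (of_real ((norm l)\<^sup>2) * z) \<le> (norm l)\<^sup>2"
    using z by (simp add: norm_mult norm_power mult_left_le)
  have "z - l + cnj l * (z * z) = (z - l) * (1 + cnj l * z) + of_real ((norm l)\<^sup>2) * z"
    unfolding complex_norm_square by (simp add: algebra_simps)
  also have "norm \<dots> \<le> (1 + (norm l)\<^sup>2) + (norm l)\<^sup>2"
    by (rule norm_triangle_mono[OF 1 2])
  finally show ?thesis by simp
qed

context ellipse_operator
begin

text \<open>Normalizing by \<open>m + e\<close> covers m = 0, which occurs for the circle, where the
  distance to a constant is zero.\<close>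

lemma op_poly_scaled_bound:
  assumes K: "K \<ge> 0" "\<And>f x. contractive f \<Longrightarrow> norm (op_poly f S x) \<le> K * norm x"
    and m: "m \<ge> 0" "\<And>s. norm s = 1 \<Longrightarrow> norm (poly h (bdry s)) \<le> m"
  shows "norm (op_poly h S x) \<le> K * m * norm x"
proof (rule le_of_le_add_small_mult)
  fix e :: real assume e: "0 < e"
  have "contractive (smult (of_real (inverse (m + e))) h)"
    unfolding contractive_def
  proof (intro allI impI)
    fix s :: complex assume "norm s = 1"
    hence "norm (poly h (bdry s)) \<le> m + e" using m(2)[of s] e by simp
    thus "norm (poly (smult (of_real (inverse (m + e))) h) (bdry s)) \<le> 1"
      using m(1) e by (simp only: poly_smult norm_mult norm_of_real) (simp add: field_simps)
  qed
  from K(2)[OF this, of x] have "inverse (m + e) * norm (op_poly h S x) \<le> K * norm x"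
    using m(1) e by (simp only: op_poly_smult norm_scaleC norm_of_real) simp
  hence "norm (op_poly h S x) \<le> (m + e) * (K * norm x)"
    using m(1) e by (simp add: field_simps)
  thus "norm (op_poly h S x) \<le> K * m * norm x + e * (K * norm x)"
    by (simp add: algebra_simps)
qed

text \<open>If \<open>f\<close> and \<open>x\<close> were exactly extremal, i.e. \<open>t = 0\<close>, then \<open>f(S)\<close> would attain its norm \<open>K\<close> at \<open>x\<close>,
  so that \<open>f(S)\<^sup>* y = K x\<close>, and extremality of \<open>f\<close> among Moebius perturbations would make \<open>y\<close>
  orthogonal to \<open>x\<close>. The orthogonality allows subtracting a constant from \<open>g\<close>.\<close>

lemma near_extremal:
  fixes a0 :: real
  defines "a0 \<equiv> 4 / pi * arctan \<bar>q\<bar>"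
  assumes K: "K \<ge> 2" "\<And>f x. contractive f \<Longrightarrow> norm (op_poly f S x) \<le> K * norm x"
    and f: "contractive f" and x: "norm x = 1"
    and t: "0 < t" "t \<le> 1" "K - t\<^sup>2 \<le> norm (op_poly f S x)"
  shows "K\<^sup>2 - 2 * K - a0 \<le> 0 + t * (2 * K + K * (K * a0 + (K + 1)\<^sup>2))"
proof -
  define k where "k = norm (op_poly f S x)"
  define y where "y = (1 / k) *\<^sub>R op_poly f S x"
  have t2: "t\<^sup>2 \<le> t"
    using t by (simp add: power2_eq_square mult_left_le)
  have k: "1 \<le> k" "k \<le> K" "K - t\<^sup>2 \<le> k"
    using K(1) K(2)[OF f, of x] t t2 x by (auto simp: k_def)
  have y: "norm y = 1" "op_poly f S x = k *\<^sub>R y"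
    using k by (auto simp: y_def k_def)
  have fxy: "cinner (op_poly f S x) y = of_real k"
    by (simp add: y cinner_scaleR_left cinner_self)
  have a0: "a0 \<ge> 0"
    by (simp add: a0_def)
  note scaled = op_poly_scaled_bound[OF _ K(2)]

  \<comment> \<open>Variation of the vector: compare x + t w with \<open>x\<close>. Dividing the
    defect t^2 by the step \<open>t\<close> leaves an error of order \<open>t\<close>.\<close>
  have adj1: "norm (cinner (op_poly f S v) y - of_real K * cinner v x) \<le> t * K" if v: "norm v = 1" for v
  proof -
    define D where "D = cinner (op_poly f S v) y - of_real K * cinner v x"
    obtain c where c: "norm c = 1" "c * D = of_real (norm D)"
      using exists_phase by blast
    define w where "w = c *\<^sub>C v"
    have w: "norm w = 1"
      using c v by (simp add: w_def norm_scaleC)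
    have "cinner (op_poly f S w) y - of_real K * cinner w x = c * D"
      by (simp add: w_def D_def op_poly_scaleC_arg[OF S] cinner_scaleC_left algebra_simps)
    hence "cinner (op_poly f S w) y - of_real K * cinner w x = of_real (norm D)"
      by (simp only: c(2))
    from arg_cong[OF this, of Re]
    have D: "Re (cinner (op_poly f S w) y) - K * Re (cinner w x) = norm D"
      by simp
    have "k + t * Re (cinner (op_poly f S w) y) = Re (cinner (op_poly f S (x + t *\<^sub>R w)) y)"
      by (simp add: op_poly_add_arg[OF S] op_poly_scaleR_arg[OF S] cinner_add_left fxy
          cinner_scaleR_left)
    also have "\<dots> \<le> norm (op_poly f S (x + t *\<^sub>R w)) * norm y"
      by (rule order.trans[OF complex_Re_le_cmod norm_cinner_le])
    also have "\<dots> \<le> K * norm (x + t *\<^sub>R w)"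
      using K(2)[OF f] by (simp add: y)
    \<comment> \<open>A bound for the norm that is exact to first order at norm 1 and avoids the
      square root.\<close>
    also have "\<dots> \<le> K * ((1 + (norm (x + t *\<^sub>R w))\<^sup>2) / 2)"
    proof (rule mult_left_mono)
      show "norm (x + t *\<^sub>R w) \<le> (1 + (norm (x + t *\<^sub>R w))\<^sup>2) / 2"
        using zero_le_power2[of "norm (x + t *\<^sub>R w) - 1"] by (simp add: power2_diff)
    qed (use K in simp)
    also have "(norm (x + t *\<^sub>R w))\<^sup>2 = 1 + 2 * t * Re (cinner w x) + t\<^sup>2"
    proof -
      have "(norm (x + t *\<^sub>R w))\<^sup>2 = (norm x)\<^sup>2 + 2 * t * inner w x + t\<^sup>2 * (norm w)\<^sup>2"
        using inner_commute[of x w] unfolding power2_norm_eq_inner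
        by (simp add: inner_add_left inner_add_right power2_eq_square algebra_simps)
      thus ?thesis by (simp add: x w inner_eq_Re_cinner)
    qed
    finally have "t * norm D \<le> (K - k) + K * t\<^sup>2 / 2"
      unfolding D[symmetric] by (simp add: algebra_simps add_divide_distrib)
    also have "\<dots> \<le> t\<^sup>2 + K * t\<^sup>2 / 2"
      using k by simp
    also have "\<dots> \<le> K * t\<^sup>2"
      using K(1) mult_right_mono[of 2 K "t\<^sup>2"] by simp
    finally have "t * norm D \<le> t * (t * K)"
      by (simp add: power2_eq_square mult_ac)
    thus ?thesis
      using t by (simp add: D_def)
  qed
  have adj: "norm (cinner (op_poly f S v) y - of_real K * cinner v x) \<le> t * K * norm v" for v
  proof (cases "v = 0")
    case True
    have "op_poly f S 0 = 0"
      using op_poly_scaleC_arg[OF S, of f 0 0] by simp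
    thus ?thesis using True by simp
  next
    case False
    define w where "w = (1 / norm v) *\<^sub>R v"
    have w: "norm w = 1" "v = of_real (norm v) *\<^sub>C w"
      using False by (auto simp: w_def scaleC_of_real)
    have "cinner (op_poly f S v) y - of_real K * cinner v x
        = of_real (norm v) * (cinner (op_poly f S w) y - of_real K * cinner w x)"
      by (subst (1 2) w(2))
        (simp add: op_poly_scaleC_arg[OF S] cinner_scaleC_left algebra_simps)
    thus ?thesis
      using mult_left_mono[OF adj1[OF w(1)] norm_ge_zero[of v]]
      by (simp add: norm_mult mult_ac)
  qed

  have orth: "norm (cinner y x) \<le> t * (K + 1)\<^sup>2"
  proof -
    define X where "X = norm (cinner y x)"
    obtain c where c: "norm c = 1" "c * cinner y x = of_real X"
      using exists_phase X_def by metis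
    \<comment> \<open>This phase makes both first-order terms real: the constant \<open>l\<close>
      lowers the pairing with \<open>y\<close> by t X, while the quadratic term raises it by about k
      K t X. As k K - 1 >= 1, extremality forces \<open>X\<close> to be of order
      \<open>t\<close>.\<close>
    define l where "l = of_real t * cnj c"
    have l: "norm l = t" "cnj l * cinner y x = of_real (t * X)"
      using c t by (simp_all add: l_def norm_mult mult.assoc)
    have l': "l * cinner x y = of_real (t * X)"
      using arg_cong[OF l(2), of cnj] by (simp flip: cinner_commute)
    define p where "p = f - [:l:] + smult (cnj l) (f * f)"
    define D where "D = cinner (op_poly f S y) y - of_real K * cinner y x"
    have D: "norm D \<le> t * K"
      using adj[of y] y by (simp add: D_def)
    have "cinner (op_poly p S x) y = cinner (op_poly f S x) y - l * cinner x y
        + cnj l * cinner (op_poly f S (op_poly f S x)) y"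
      by (simp add: p_def op_poly_add op_poly_diff op_poly_smult op_poly_mult[OF S] op_poly_pCons
          cinner_add_left cinner_diff_left cinner_scaleC_left)
    also have "cinner (op_poly f S (op_poly f S x)) y = of_real k * (of_real K * cinner y x + D)"
      by (simp add: y(2) op_poly_scaleR_arg[OF S] cinner_scaleR_left D_def)
    also have "cnj l * (of_real k * (of_real K * cinner y x + D))
        = of_real (k * K) * (cnj l * cinner y x) + of_real k * (cnj l * D)"
      by (simp add: algebra_simps)
    finally have "cinner (op_poly p S x) y = of_real (k - t * X + k * K * (t * X)) + of_real k * (cnj l * D)"
      unfolding fxy l l' by simp
    hence "Re (cinner (op_poly p S x) y) = k - t * X + k * K * (t * X) + k * Re (cnj l * D)"
      by (simp only: plus_complex.sel Re_complex_of_real) simp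
    moreover have "k * Re (cnj l * D) \<ge> k * (- (t * (t * K)))"
    proof (rule mult_left_mono)
      have "norm (cnj l * D) \<le> t * (t * K)"
        unfolding norm_mult complex_mod_cnj l(1) using t D by (intro mult_left_mono) auto
      thus "- (t * (t * K)) \<le> Re (cnj l * D)"
        using abs_Re_le_cmod[of "cnj l * D"] by linarith
    qed (use k in simp)
    moreover have "Re (cinner (op_poly p S x) y) \<le> K * (1 + 2 * t\<^sup>2)"
    proof -
      have "norm (op_poly p S x) \<le> K * (1 + 2 * t\<^sup>2) * norm x"
      proof (rule scaled)
        fix s :: complex assume "norm s = 1"
        hence "norm (poly f (bdry s)) \<le> 1"
          using f by (simp add: contractive_def)
        thus "norm (poly p (bdry s)) \<le> 1 + 2 * t\<^sup>2"
          using norm_moebius_perturbation_le[of "poly f (bdry s)" l] t l(1) by (simp add: p_def)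
      qed (use K in auto)
      thus ?thesis
        using order.trans[OF complex_Re_le_cmod norm_cinner_le, of "op_poly p S x" y] x y by simp
    qed
    moreover have "k * (t * (t * K)) \<le> K * (t * (t * K))"
      using k K(1) t by (intro mult_right_mono) auto
    ultimately have "(k * K - 1) * (t * X) \<le> t\<^sup>2 + 2 * K * t\<^sup>2 + K * (t * (t * K))"
      using k(3) by (simp add: algebra_simps)
    also have "\<dots> = t * (t * (K + 1)\<^sup>2)"
      by (simp add: power2_eq_square algebra_simps)
    finally have 1: "(k * K - 1) * (t * X) \<le> t * (t * (K + 1)\<^sup>2)" .
    have "1 \<le> k * K - 1"
      using mult_mono[of 1 k 2 K] k K(1) by simp
    hence "1 * (t * X) \<le> (k * K - 1) * (t * X)"
      using t by (intro mult_right_mono) (auto simp: X_def)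
    hence "t * X \<le> t * (t * (K + 1)\<^sup>2)"
      using 1 by simp
    thus ?thesis using t by (simp add: X_def)
  qed

  obtain g where g: "cauchy_conj f g"
    using ex_cauchy_conj by blast
  obtain c where c: "norm c \<le> 1"
    "\<And>s. norm s = 1 \<Longrightarrow> norm (poly (g - [:c:]) (bdry s)) \<le> a0"
    using cauchy_conj_near_constant[OF g] f unfolding contractive_def a0_def by metis
  define h where "h = g - [:c:]"
  have hy: "norm (op_poly h S y) \<le> K * a0"
    using scaled[of a0 h y] c(2) K(1) a0 y by (simp add: h_def)
  \<comment> \<open>The right factor \<open>f\<close> yields \<open>k\<close>, the left one yields
    \<open>K\<close> through \<open>adj\<close>. Both multiply the pairing of \<open>h(S) y\<close>
    with \<open>x\<close>, against the bound \<open>K * a0\<close>.\<close>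
  have "norm (op_poly (f * (h * f)) S x) \<le> K * a0 * norm x"
  proof (rule scaled)
    fix s :: complex assume s: "norm s = 1"
    hence fs: "norm (poly f (bdry s)) \<le> 1"
      using f by (simp add: contractive_def)
    have "norm (poly f (bdry s)) * (norm (poly h (bdry s)) * norm (poly f (bdry s))) \<le> 1 * (a0 * 1)"
      using fs c(2)[OF s] a0 by (intro mult_mono) (auto simp: h_def)
    thus "norm (poly (f * (h * f)) (bdry s)) \<le> a0"
      by (simp add: norm_mult)
  qed (use K a0 in auto)
  moreover have "op_poly (f * (h * f)) S x = k *\<^sub>R op_poly f S (op_poly h S y)"
    by (simp add: op_poly_mult[OF S] y(2) op_poly_scaleR_arg[OF S])
  ultimately have "k * norm (op_poly f S (op_poly h S y)) \<le> K * a0"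
    using k x by simp
  moreover have "norm (cinner (op_poly f S (op_poly h S y)) y) \<le> norm (op_poly f S (op_poly h S y))"
    using norm_cinner_le[of _ y] y by simp
  hence "k * norm (cinner (op_poly f S (op_poly h S y)) y) \<le> k * norm (op_poly f S (op_poly h S y))"
    using k by (intro mult_left_mono) auto
  ultimately have "k * norm (cinner (op_poly f S (op_poly h S y)) y) \<le> K * a0"
    by linarith
  moreover have "norm (of_real K * cinner (op_poly h S y) x)
      \<le> norm (cinner (op_poly f S (op_poly h S y)) y) + t * K * (K * a0)"
  proof -
    have "t * K * norm (op_poly h S y) \<le> t * K * (K * a0)"
      using t K(1) hy by (intro mult_left_mono) auto
    thus ?thesis
      using adj[of "op_poly h S y"]
        norm_triangle_ineq3[of "cinner (op_poly f S (op_poly h S y)) y" "of_real K * cinner (op_poly h S y) x"]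
      by linarith
  qed
  from mult_left_mono[OF this, of k]
  have "k * (K * norm (cinner (op_poly h S y) x))
      \<le> k * norm (cinner (op_poly f S (op_poly h S y)) y) + k * (t * K * (K * a0))"
    using k K(1) by (simp add: norm_mult distrib_left)
  ultimately have "K * (k * norm (cinner (op_poly h S y) x)) \<le> K * (a0 + k * (t * (K * a0)))"
    by (simp add: algebra_simps)
  hence hyx: "k * norm (cinner (op_poly h S y) x) \<le> a0 + k * (t * (K * a0))"
    using K(1) by simp

  \<comment> \<open>Here \<open>k\<close> is the pairing of \<open>f(S) x\<close> with
    \<open>y\<close>; the bound 2 is applied with g = h + c, and \<open>orth\<close> will control
    the contribution of \<open>c\<close>.\<close>
  have "k \<le> 2 + norm (cinner (op_poly h S y) x) + norm (cinner y x)"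
  proof -
    have sym: "norm (cinner u v) = norm (cinner v u)" for u v :: 'a
      by (metis cinner_commute complex_mod_cnj)
    have "op_poly g S y = op_poly h S y + c *\<^sub>C y"
      by (simp add: h_def op_poly_diff op_poly_pCons)
    hence "cinner x (op_poly g S y) = cinner x (op_poly h S y) + cnj c * cinner x y"
      by (simp add: cinner_add_right cinner_scaleC_right)
    hence "of_real k = (cinner (op_poly f S x) y + cinner x (op_poly g S y))
        - cinner x (op_poly h S y) - cnj c * cinner x y"
      by (simp add: fxy)
    hence "norm (complex_of_real k) \<le> norm (cinner (op_poly f S x) y + cinner x (op_poly g S y))
        + norm (cinner x (op_poly h S y)) + norm (cnj c * cinner x y)"
      by (metis (no_types, lifting) add_right_mono norm_triangle_ineq4 order.trans)
    moreover have "norm (cnj c * cinner x y) \<le> 1 * norm (cinner x y)"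
      unfolding norm_mult using c(1) by (intro mult_right_mono) auto
    ultimately show ?thesis
      using cauchy_conj_operator_bound[OF g f x y(1)] k sym[of x] by simp
  qed
  from mult_left_mono[OF this, of k]
  have "k * k \<le> 2 * k + k * norm (cinner (op_poly h S y) x) + k * norm (cinner y x)"
    using k by (simp add: algebra_simps)
  also have "\<dots> \<le> 2 * k + (a0 + k * (t * (K * a0))) + k * (t * (K + 1)\<^sup>2)"
    using k by (intro add_mono mult_left_mono hyx orth) auto
  also have "\<dots> = 2 * k + a0 + k * (t * (K * a0 + (K + 1)\<^sup>2))"
    by (simp add: algebra_simps)
  also have "k * (t * (K * a0 + (K + 1)\<^sup>2)) \<le> K * (t * (K * a0 + (K + 1)\<^sup>2))"
    using k t K(1) a0 by (intro mult_right_mono) auto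
  finally have 1: "k * k - 2 * k - a0 \<le> t * (K * (K * a0 + (K + 1)\<^sup>2))"
    by (simp add: mult_ac)
  have "(K - k) * (K + k) \<le> t * (2 * K)"
    using k t2 K(1) t by (intro mult_mono) auto
  hence "K\<^sup>2 - 2 * K \<le> k * k - 2 * k + t * (2 * K)"
    using k by (simp add: power2_eq_square algebra_simps)
  thus ?thesis
    using 1 by (simp add: algebra_simps)
qed

text \<open>Arguing by contradiction supplies the hypothesis \<open>K \<ge> 2\<close> of
  \<open>near_extremal\<close>: a violation gives K > b >= 2, where \<open>b\<close> is the larger
  root of z^2 - 2 z - a0.\<close>

lemma contractive_imp_norm_le:
  assumes f: "contractive f"
  shows "norm (op_poly f S x) \<le> (1 + sqrt (1 + 4 / pi * arctan \<bar>q\<bar>)) * norm x"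
proof (rule ccontr)
  define a0 where "a0 = 4 / pi * arctan \<bar>q\<bar>"
  define b where "b = 1 + sqrt (1 + a0)"
  define N where "N = {norm (op_poly f S x) | f x. contractive f \<and> norm x = 1}"
  define K where "K = Sup N"
  have a0: "a0 \<ge> 0" by (simp add: a0_def)
  have normalize: "norm (op_poly f S x) = norm x * norm (op_poly f S ((1 / norm x) *\<^sub>R x))" if "x \<noteq> 0" for f x
    using that by (simp add: op_poly_scaleR_arg[OF S])
  obtain M where M: "M > 0" "\<And>f x. contractive f \<Longrightarrow> norm (op_poly f S x) \<le> M * norm x"
    using op_poly_bounded by blast
  have bdd: "bdd_above N"
  proof (rule bdd_aboveI)
    fix z assume "z \<in> N"
    then obtain f x where "contractive f" "norm x = 1" "z = norm (op_poly f S x)"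
      unfolding N_def by blast
    thus "z \<le> M" using M(2)[of f x] by simp
  qed
  assume "\<not> norm (op_poly f S x) \<le> (1 + sqrt (1 + 4 / pi * arctan \<bar>q\<bar>)) * norm x"
  hence big: "norm (op_poly f S x) > b * norm x"
    by (simp add: b_def a0_def)
  have x: "x \<noteq> 0"
    using big M(2)[OF f, of x] by auto
  have fN: "norm (op_poly f S ((1 / norm x) *\<^sub>R x)) \<in> N"
    unfolding N_def using f x by (auto intro!: exI[of _ f] exI[of _ "(1 / norm x) *\<^sub>R x"])
  have "norm x * b < norm x * norm (op_poly f S ((1 / norm x) *\<^sub>R x))"
    using big normalize[OF x, of f] by (simp add: mult.commute)
  hence "b < norm (op_poly f S ((1 / norm x) *\<^sub>R x))"
    using x by simp
  also have "\<dots> \<le> K"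
    unfolding K_def by (rule cSup_upper[OF fN bdd])
  finally have Kb: "b < K" .
  have "sqrt (1 + a0) \<ge> 1" using a0 by simp
  hence K2: "K \<ge> 2" using Kb unfolding b_def by linarith
  have K: "norm (op_poly f S x) \<le> K * norm x" if "contractive f" for f x
  proof (cases "x = 0")
    case True
    thus ?thesis using M(2)[OF that, of x] by simp
  next
    case False
    have "norm (op_poly f S ((1 / norm x) *\<^sub>R x)) \<le> K"
      unfolding K_def
      by (rule cSup_upper[OF _ bdd])
        (use that False in \<open>auto simp: N_def intro!: exI[of _ f] exI[of _ "(1 / norm x) *\<^sub>R x"]\<close>)
    thus ?thesis
      unfolding normalize[OF False, of f] by (metis mult.commute mult_left_mono norm_ge_zero)
  qed
  have "K\<^sup>2 - 2 * K - a0 \<le> 0"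
  proof (rule le_of_le_add_small_mult)
    fix t :: real assume t: "0 < t" "t \<le> 1"
    have "K - t\<^sup>2 < Sup N"
      using t by (simp add: K_def)
    then obtain f x where "contractive f" "norm x = 1" "K - t\<^sup>2 < norm (op_poly f S x)"
      using less_cSup_iff[of N "K - t\<^sup>2"] fN bdd by (auto simp: N_def)
    thus "K\<^sup>2 - 2 * K - a0 \<le> 0 + t * (2 * K + K * (K * a0 + (K + 1)\<^sup>2))"
      unfolding a0_def using near_extremal[OF K2 K _ _ t] by simp
  qed
  moreover have "(sqrt (1 + a0))\<^sup>2 < (K - 1)\<^sup>2"
    using Kb a0 by (intro power_strict_mono) (auto simp: b_def)
  ultimately show False
    using a0 by (simp add: power2_eq_square algebra_simps)
qed

end

section \<open>The ellipse\<close>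

lemma norm_op_poly_shrunk_le:
  fixes T :: "'a::complex_hilbert_space \<Rightarrow> 'a"
  assumes ab: "a > 0" "b > 0" and T: "bounded_clinear T"
    and range: "numerical_range T \<subseteq> ellipse_region a b"
    and r: "0 \<le> r" "r < 1" and m: "m > 0" "\<And>z. z \<in> ellipse_region a b \<Longrightarrow> norm (poly p z) \<le> m"
  shows "norm (op_poly p (\<lambda>x. r *\<^sub>R T x) x) \<le> ellipse_const a b * m * norm x"
proof -
  define al where "al = (a + b) / 2"
  define be where "be = (a - b) / 2"
  have sum: "al + be = a" "al - be = b" by (simp_all add: al_def be_def field_simps)
  have prod: "al\<^sup>2 - be\<^sup>2 = a * b"
    by (simp add: al_def be_def power2_eq_square field_simps)
  have Re: "Re ((of_real al * u - of_real be * cnj u) * z) = b * Re u * Re z - a * Im u * Im z" for u z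
    unfolding sum[symmetric] by (simp add: algebra_simps)
  \<comment> \<open>The half plane tangent to the ellipse at \<open>bdry u\<close>, by
    Cauchy-Schwarz in coordinates that turn the ellipse into the disc.\<close>
  have cs: "b * Re u * Re z - a * Im u * Im z \<le> a * b"
    if u: "norm u = 1" and z: "z \<in> ellipse_region a b" for u z
  proof -
    define X where "X = Re z / a"
    define Y where "Y = Im z / b"
    have "X\<^sup>2 + Y\<^sup>2 \<le> 1"
      using z by (simp add: ellipse_region_def X_def Y_def power_divide)
    moreover have "(Re u)\<^sup>2 + (Im u)\<^sup>2 = 1"
      using cmod_power2[of u] u by simp
    moreover have "0 \<le> (Re u - X)\<^sup>2 + (Im u + Y)\<^sup>2"
      by simp
    ultimately have "Re u * X - Im u * Y \<le> 1"
      unfolding power2_diff power2_sum by linarith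
    hence "(a * b) * (Re u * X - Im u * Y) \<le> (a * b) * 1"
      using ab by (intro mult_left_mono) auto
    moreover have "(a * b) * (Re u * X - Im u * Y) = b * Re u * Re z - a * Im u * Im z"
      using ab by (simp add: X_def Y_def field_simps)
    ultimately show ?thesis by simp
  qed
  interpret ellipse_param al be
    by standard (use ab in \<open>simp add: al_def be_def abs_less_iff field_simps\<close>)
  interpret ellipse_operator al be "\<lambda>x. r *\<^sub>R T x" r
  proof
    show "bounded_clinear (\<lambda>x. r *\<^sub>R T x)"
      using T by (auto simp: bounded_clinear_def scaleC_scaleR intro: bounded_linear_const_scaleR
          bounded_linear_compose[OF bounded_linear_scaleR_right])
    fix u :: complex and x :: 'a assume u: "norm u = 1"
    show "Re ((of_real al * u - of_real be * cnj u) * cinner (r *\<^sub>R T x) x) \<le> r * (al\<^sup>2 - be\<^sup>2) * (norm x)\<^sup>2"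
    proof (cases "x = 0")
      case False
      define w where "w = (1 / norm x) *\<^sub>R x"
      define z where "z = cinner (T w) w"
      have w: "norm w = 1" "x = of_real (norm x) *\<^sub>C w"
        using False by (auto simp: w_def scaleC_of_real)
      have "z \<in> ellipse_region a b"
        using range w(1) by (auto simp: numerical_range_def z_def)
      hence "Re ((of_real al * u - of_real be * cnj u) * z) \<le> a * b"
        unfolding Re by (rule cs[OF u])
      hence "(r * (norm x)\<^sup>2) * Re ((of_real al * u - of_real be * cnj u) * z) \<le> (r * (norm x)\<^sup>2) * (a * b)"
        using r by (intro mult_left_mono) auto
      moreover have "cinner (r *\<^sub>R T x) x = of_real (r * (norm x)\<^sup>2) * z"
        by (subst (1 2) w(2)) (simp add: clinear_scaleC[OF T] cinner_scaleC_left cinner_scaleC_right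
            z_def power2_eq_square flip: scaleC_of_real)
      hence "Re ((of_real al * u - of_real be * cnj u) * cinner (r *\<^sub>R T x) x)
          = (r * (norm x)\<^sup>2) * Re ((of_real al * u - of_real be * cnj u) * z)"
        by (simp only: mult.left_commute[of _ "of_real (r * (norm x)\<^sup>2)"]) simp
      ultimately show ?thesis
        unfolding prod by (simp add: mult_ac)
    qed simp
  qed (use r in auto)
  have bdry_mem: "bdry s \<in> ellipse_region a b" if "norm s = 1" for s
  proof -
    have "Re (bdry s) = a * Re s" "Im (bdry s) = - (b * Im s)"
      unfolding sum[symmetric] bdry_def by (simp_all add: algebra_simps)
    thus ?thesis
      using ab cmod_power2[of s] that by (simp add: ellipse_region_def power_mult_distrib)
  qed
  have q: "q = (a - b) / (a + b)"
    unfolding q_def unfolding al_def be_def using ab by (simp add: field_simps)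
  have const: "1 + sqrt (1 + 4 / pi * arctan \<bar>q\<bar>) = ellipse_const a b"
  proof -
    \<comment> \<open>The doubling formula stays on the principal branch because |q| < 1.\<close>
    have "2 * arctan \<bar>q\<bar> = arctan (2 * \<bar>q\<bar> / (1 - \<bar>q\<bar>\<^sup>2))"
      using abs_q by (intro arctan_double) auto
    also have "2 * \<bar>q\<bar> / (1 - \<bar>q\<bar>\<^sup>2) = 1 / 2 * \<bar>b / a - a / b\<bar>"
    proof -
      have 1: "1 - \<bar>q\<bar>\<^sup>2 = 4 * a * b / (a + b)\<^sup>2"
        using ab by (simp add: q power_divide field_simps) (simp add: power2_eq_square algebra_simps)
      have "b / a - a / b = - ((a - b) * (a + b) / (a * b))"
        using ab by (simp add: field_simps)
      hence 2: "\<bar>b / a - a / b\<bar> = \<bar>a - b\<bar> * (a + b) / (a * b)"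
        using ab by (simp add: abs_mult)
      have 3: "\<bar>q\<bar> = \<bar>a - b\<bar> / (a + b)"
        using ab by (simp add: q)
      show ?thesis
        unfolding 1 2 unfolding 3 using ab by (simp add: power2_eq_square)
    qed
    finally show ?thesis
      by (simp add: ellipse_const_def field_simps)
  qed
  have "ellipse_const a b \<ge> 0"
    unfolding const[symmetric] by simp
  thus ?thesis
    using m bdry_mem contractive_imp_norm_le[unfolded const]
    by (intro op_poly_scaled_bound) auto
qed

section \<open>Passage from the shrunk operator to \<open>T\<close>\<close>

lemma op_poly_scaleR_op:
  assumes T: "bounded_clinear T"
  shows "op_poly p (\<lambda>x. r *\<^sub>R T x) x = (\<Sum>i\<le>degree p. r ^ i *\<^sub>R (coeff p i *\<^sub>C (T ^^ i) x))"
proof -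
  have "((\<lambda>x. r *\<^sub>R T x) ^^ i) x = r ^ i *\<^sub>R (T ^^ i) x" for i
    by (induction i) (simp_all add: clinear_scaleR[OF T])
  thus ?thesis
    by (simp add: op_poly_def scaleC_scaleR)
qed

lemma compact_ellipse_region:
  assumes "a > 0" "b > 0"
  shows "compact (ellipse_region a b)"
proof -
  have "closed (ellipse_region a b)"
    unfolding ellipse_region_def
    by (intro closed_Collect_le continuous_intros) (use assms in auto)
  moreover have "norm z \<le> a + b" if "z \<in> ellipse_region a b" for z
  proof -
    have "(Re z)\<^sup>2 / a\<^sup>2 + (Im z)\<^sup>2 / b\<^sup>2 \<le> 1"
      using that by (simp add: ellipse_region_def)
    moreover have "(Re z)\<^sup>2 / a\<^sup>2 \<ge> 0" "(Im z)\<^sup>2 / b\<^sup>2 \<ge> 0"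
      by simp_all
    ultimately have "(Re z)\<^sup>2 / a\<^sup>2 \<le> 1" "(Im z)\<^sup>2 / b\<^sup>2 \<le> 1"
      by linarith+
    hence "\<bar>Re z\<bar> \<le> a" "\<bar>Im z\<bar> \<le> b"
      using assms by (simp_all add: divide_le_eq abs_le_square_iff[symmetric])
    thus ?thesis
      using cmod_le[of z] by linarith
  qed
  hence "bounded (ellipse_region a b)"
    by (rule boundedI)
  ultimately show ?thesis
    by (simp add: compact_eq_bounded_closed)
qed

theorem corollary5:
  fixes a b :: real
    and T :: "'a::complex_hilbert_space \<Rightarrow> 'a"
    and p :: "complex poly"
  assumes "a > 0" and "b > 0"
    and "bounded_clinear T"
    and "numerical_range T \<subseteq> ellipse_region a b"
  shows "onorm (op_poly p T) \<le> ellipse_const a b * (SUP z\<in>ellipse_region a b. norm (poly p z))"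
proof -
  define m where "m = (SUP z\<in>ellipse_region a b. norm (poly p z))"
  have "compact ((\<lambda>z. norm (poly p z)) ` ellipse_region a b)"
    by (intro compact_continuous_image continuous_intros compact_ellipse_region assms)
  hence bdd: "bdd_above ((\<lambda>z. norm (poly p z)) ` ellipse_region a b)"
    by (intro bounded_imp_bdd_above compact_imp_bounded)
  have le_m: "norm (poly p z) \<le> m" if "z \<in> ellipse_region a b" for z
    unfolding m_def by (rule cSUP_upper[OF that bdd])
  have "0 \<in> ellipse_region a b"
    by (simp add: ellipse_region_def)
  from order.trans[OF norm_ge_zero le_m[OF this]] have m: "m \<ge> 0" .
  have const: "ellipse_const a b \<ge> 0"
    by (simp add: ellipse_const_def)
  have "norm (op_poly p T x) \<le> ellipse_const a b * m * norm x" for x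
  proof (rule le_of_le_add_small_mult)
    fix e :: real assume e: "e > 0"
    define F where "F r = op_poly p (\<lambda>x. r *\<^sub>R T x) x" for r :: real
    \<comment> \<open>For fixed \<open>x\<close> the dependence on \<open>r\<close> is polynomial,
      so the limit is taken termwise. The slack \<open>e\<close> provides the strictly positive
      bound that the shrunk estimate requires.\<close>
    have "(F \<longlongrightarrow> F 1) (at_left 1)"
      unfolding F_def op_poly_scaleR_op[OF assms(3)] by (intro tendsto_intros)
    hence "((\<lambda>r. norm (F r)) \<longlongrightarrow> norm (F 1)) (at_left 1)"
      by (rule tendsto_norm)
    moreover have "eventually (\<lambda>r. norm (F r) \<le> ellipse_const a b * (m + e) * norm x) (at_left 1)"
      using eventually_at_left_real[of 0 1]
    proof (rule eventually_mono)
      fix r :: real assume "r \<in> {0<..<1}"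
      thus "norm (F r) \<le> ellipse_const a b * (m + e) * norm x"
        unfolding F_def using m e le_m
        by (intro norm_op_poly_shrunk_le assms) (auto intro: add_increasing2)
    qed simp
    ultimately have "norm (F 1) \<le> ellipse_const a b * (m + e) * norm x"
      by (rule tendsto_upperbound) simp
    thus "norm (op_poly p T x) \<le> ellipse_const a b * m * norm x + e * (ellipse_const a b * norm x)"
      by (simp add: F_def algebra_simps)
  qed
  thus ?thesis
    unfolding m_def[symmetric] using m const by (intro onorm_bound) auto
qed

end
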